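(* Consider a sequence of screening problems indexed by the number of alternatives $k$, with $m>1$ and $\delta>0$ fixed. In the problem with $k$ alternatives, alternative $i$ produces i.i.d. $\mathrm{Normal}(\mu_i,\sigma_i^2)$ observations, independent across alternatives, with $\mu_1\ge\dots\ge\mu_k$; let $\mathcal{G}=\{i:\mu_i\ge\mu_m-\delta\}$. Assume there is $\bar\sigma>0$ with $\max_i\sigma_i^2\le\bar\sigma^2$ for every $k$, and $\bar g$ with $|\mathcal{G}|\le\bar g$ for every $k$. For any $\alpha\in(0,1)$, if the EFG-$m$ algorithm is run with total budget $B=(n_0+n_g)k$, where $$n_0=\frac{8\bar\sigma^2}{\delta^2}\log\frac{2m}{\alpha},\qquad n_g\ge\frac{\alpha}{2}+\frac{4\alpha\bar\sigma^2}{\delta^2},$$ then $\liminf_{k\to\infty}\mathrm{PGS}_m\ge1-\alpha$. Consequently EFG-$m$ is consistent, i.e., for every $\alpha\in(0,1)$ there exists $c>0$ such that $\liminf_{k\to\infty}\mathrm{PGS}_m\ge1-\alpha$ when $B=ck$.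
   Context: EFG-$m$ (explore-first top-$m$ greedy) algorithm, with inputs $m$, $k$, total budget $B$ and exploration size $n_0$ with $n_0k<B$: (exploration) take $n_0$ observations from each alternative and set $n_i=n_0$; (greedy) while $\sum_i n_i<B$, let $S$ be the indices of the $m$ largest current sample means, take one additional observation from each $j\in S$ and update its sample mean and count. The output $\mathcal{S}$ is the set of indices of the $m$ largest sample means when the budget is exhausted. $\mathrm{PGS}_m=\Pr\{\mathcal{S}\subseteq\mathcal{G}\}$. *)

theory Defs
  imports "HOL-Probability.Probability"
begin

text \<open>Alternatives are indexed 0,...,k-1 (paper: 1,...,k). Observation j (0-based)
  of alternative i is the coordinate X (i, j).\<close>

definition obs_space :: "(nat \<Rightarrow> real) \<Rightarrow> (nat \<Rightarrow> real) \<Rightarrow> nat \<Rightarrow> nat \<Rightarrow> (nat \<times> nat \<Rightarrow> real) measure" where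
  "obs_space \<mu> \<sigma> k N =
     PiM ({..<k} \<times> {..<N}) (\<lambda>(i, j). density lborel (normal_density (\<mu> i) (\<sigma> i)))"

definition sample_mean :: "(nat \<times> nat \<Rightarrow> real) \<Rightarrow> (nat \<Rightarrow> nat) \<Rightarrow> nat \<Rightarrow> real" where
  "sample_mean X n i = (\<Sum>j<n i. X (i, j)) / real (n i)"

definition top_set :: "nat \<Rightarrow> nat \<Rightarrow> (nat \<Rightarrow> real) \<Rightarrow> nat set" where
  "top_set m k f = {i. i < k \<and> card {j. j < k \<and> (f j > f i \<or> (f j = f i \<and> j < i))} < m}"

fun efg_counts :: "nat \<Rightarrow> nat \<Rightarrow> nat \<Rightarrow> (nat \<times> nat \<Rightarrow> real) \<Rightarrow> nat \<Rightarrow> (nat \<Rightarrow> nat)" where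
  "efg_counts m k n0 X 0 = (\<lambda>i. n0)"
| "efg_counts m k n0 X (Suc t) =
     (let n = efg_counts m k n0 X t; S = top_set m k (sample_mean X n)
      in (\<lambda>i. if i \<in> S then Suc (n i) else n i))"

text \<open>Number of greedy rounds: the while loop stops at the first round where the
  total number of observations is no longer below the budget B.\<close>
definition efg_rounds :: "nat \<Rightarrow> nat \<Rightarrow> nat \<Rightarrow> nat \<Rightarrow> (nat \<times> nat \<Rightarrow> real) \<Rightarrow> nat" where
  "efg_rounds m k n0 B X = (LEAST t. \<not> ((\<Sum>i<k. efg_counts m k n0 X t i) < B))"

definition efg_output :: "nat \<Rightarrow> nat \<Rightarrow> nat \<Rightarrow> nat \<Rightarrow> (nat \<times> nat \<Rightarrow> real) \<Rightarrow> nat set" where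
  "efg_output m k n0 B X =
     top_set m k (sample_mean X (efg_counts m k n0 X (efg_rounds m k n0 B X)))"

text \<open>Set of good alternatives G = {i : mu_i >= mu_m - delta} (mu_m is index m-1).\<close>
definition good_set :: "nat \<Rightarrow> real \<Rightarrow> nat \<Rightarrow> (nat \<Rightarrow> real) \<Rightarrow> nat set" where
  "good_set m \<delta> k \<mu> = {i. i < k \<and> \<mu> i \<ge> \<mu> (m - 1) - \<delta>}"

text \<open>PGS_m = Pr{output subset of G}. At most n0 + B observations per alternative are ever used.\<close>
definition PGS :: "nat \<Rightarrow> real \<Rightarrow> nat \<Rightarrow> nat \<Rightarrow> nat \<Rightarrow> (nat \<Rightarrow> real) \<Rightarrow> (nat \<Rightarrow> real) \<Rightarrow> real" where
  "PGS m \<delta> k n0 B \<mu> \<sigma> =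
     (let M = obs_space \<mu> \<sigma> k (n0 + B)
      in measure M {X \<in> space M. efg_output m k n0 B X \<subseteq> good_set m \<delta> k \<mu>})"

end

theory Submission
  imports Defs
begin

text \<open>
  Let \<open>b = \<mu>\<^sub>m - \<delta>/2\<close> and call a greedy round bad if it samples an alternative outside \<open>G\<close>.
  With probability at least \<open>1 - \<alpha>/2\<close> (Ville's inequality for the exponential martingale) the
  sample means of the top \<open>m\<close> alternatives never fall below \<open>b\<close>, and then every bad round uses up
  one of the pairs \<open>(i, n)\<close> with \<open>i \<notin> G\<close> and \<open>n\<close>-th sample mean of \<open>i\<close> at least \<open>b\<close>. The number of
  such pairs is at most a sum of \<open>k\<close> independent variables with mean at most \<open>q ^ n0 / (1 - q)\<close> and
  bounded variance, where \<open>q = exp (- \<delta>\<^sup>2 / (8 \<sigma>bar\<^sup>2))\<close>; since \<open>1 / (1 - q) < 1 + 8 \<sigma>bar\<^sup>2 / \<delta>\<^sup>2\<close>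
  strictly, Chebyshev's inequality leaves a positive fraction of the rounds that are not bad.

  It remains to exclude that the last round is bad. Let \<open>w\<close> be the \<open>m\<close>-th largest among the minima
  over time of the sample means in \<open>G\<close>. Once an alternative of \<open>G\<close> with minimum at most \<open>w\<close> has
  been sampled at its minimum, the first good round is followed by good rounds only. As each good
  round samples some alternative of \<open>G\<close> with minimum at most \<open>w\<close>, a bad last round allows no more
  good rounds than the total of the argmin times over \<open>G\<close>. This total is bounded in probability
  because \<open>card G\<close> is bounded and the argmin time of the running means of a normal sequence does
  not depend on its mean and variance; it is almost surely finite because the running means tend
  to zero and become negative infinitely often.
\<close>

section \<open>Selecting the largest values\<close>

lemma top_set_subset: "top_set m k f \<subseteq> {..<k}"
  by (auto simp: top_set_def)

lemma finite_top_set [simp]: "finite (top_set m k f)"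
  by (rule finite_subset[OF top_set_subset]) simp

lemma top_set_beats:
  assumes "i \<in> top_set m k f" "j \<notin> top_set m k f" "j < k"
  shows "f i > f j \<or> f i = f j \<and> i < j"
proof (rule ccontr)
  assume "\<not> ?thesis"
  with assms have "f j > f i \<or> f j = f i \<and> j < i"
    by (metis linorder_neqE_nat linorder_neqE_linordered_idom)
  then have "{l. l < k \<and> (f l > f j \<or> f l = f j \<and> l < j)} \<subseteq> {l. l < k \<and> (f l > f i \<or> f l = f i \<and> l < i)}"
    by auto
  then have "card {l. l < k \<and> (f l > f j \<or> f l = f j \<and> l < j)}
      \<le> card {l. l < k \<and> (f l > f i \<or> f l = f i \<and> l < i)}"
    by (rule card_mono[rotated]) auto
  with assms show False
    by (auto simp: top_set_def)
qed

lemma card_top_set: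
  assumes "m \<le> k"
  shows "card (top_set m k f) = m"
proof -
  define beats where "beats j i \<longleftrightarrow> f j > f i \<or> f j = f i \<and> j < i" for i j
  define rank where "rank i = card {j. j < k \<and> beats j i}" for i
  have rank_less: "rank j < rank i" if "beats j i" "j < k" for i j
    unfolding rank_def
    by (rule psubset_card_mono) (use that in \<open>auto simp: beats_def\<close>)
  have total: "beats i j \<or> beats j i" if "i \<noteq> j" for i j
    using that by (auto simp: beats_def)
  have inj: "inj_on rank {..<k}"
    by (rule inj_onI) (metis lessThan_iff less_irrefl rank_less total)
  have "rank ` {..<k} \<subseteq> {..<k}"
  proof safe
    fix i assume "i < k"
    then have "{j. j < k \<and> beats j i} \<subset> {..<k}"
      by (auto simp: beats_def)
    from psubset_card_mono[OF _ this] show "rank i < k"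
      by (simp add: rank_def)
  qed
  then have surj: "rank ` {..<k} = {..<k}"
    using inj by (intro endo_inj_surj) auto
  have top: "top_set m k f = {i \<in> {..<k}. rank i < m}"
    by (auto simp: top_set_def rank_def beats_def)
  have "rank ` top_set m k f = {..<m}"
    unfolding top using surj assms
    by (auto simp: image_iff set_eq_iff) (metis lessThan_iff order_less_le_trans)
  moreover have "inj_on rank (top_set m k f)"
    by (rule inj_on_subset[OF inj]) (auto simp: top)
  ultimately show ?thesis
    by (metis card_image card_lessThan)
qed

lemma top_set_threshold_exists:
  fixes f :: "nat \<Rightarrow> real"
  assumes "0 < m" "m \<le> k"
  obtains w where "card {i. i < k \<and> f i > w} < m" "m \<le> card {i. i < k \<and> f i \<ge> w}"
proof -
  let ?S = "top_set m k f"
  have card_S: "card ?S = m"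
    using assms by (intro card_top_set)
  then have "?S \<noteq> {}"
    using assms by auto
  then obtain i where in_top: "i \<in> ?S" and least: "\<And>j. j \<in> ?S \<Longrightarrow> f i \<le> f j"
    using ex_is_arg_min_if_finite[of ?S f] by (auto simp: is_arg_min_linorder)
  have "card {j. j < k \<and> f j > f i} \<le> card {j. j < k \<and> (f j > f i \<or> f j = f i \<and> j < i)}"
    by (rule card_mono) auto
  also have "\<dots> < m"
    using in_top by (simp add: top_set_def)
  finally have "card {j. j < k \<and> f j > f i} < m" .
  moreover have "card ?S \<le> card {j. j < k \<and> f j \<ge> f i}"
    using least top_set_subset by (intro card_mono) force+
  ultimately show thesis
    using card_S that by simp
qed

text \<open>Ties are broken by the index, so that this needs an initial segment of the indices.\<close>

lemma top_set_subset_lessThan: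
  assumes "m \<le> k" "g \<le> k" and many: "m \<le> card {i. i < g \<and> w \<le> f i}"
    and low: "\<And>i. g \<le> i \<Longrightarrow> i < k \<Longrightarrow> f i \<le> w"
  shows "top_set m k f \<subseteq> {..<g}"
proof (rule ccontr)
  let ?S = "top_set m k f"
  assume "\<not> ?thesis"
  then obtain i where in_top: "i \<in> ?S" "g \<le> i"
    by (force simp: subset_eq not_less)
  then have "f i \<le> w"
    using low top_set_subset by blast
  then have "{j. j < g \<and> w \<le> f j} \<subseteq> ?S - {i}"
    using top_set_beats[OF in_top(1)] in_top(2) assms(2) by fastforce
  then have "card {j. j < g \<and> w \<le> f j} \<le> card (?S - {i})"
    by (intro card_mono) auto
  also have "\<dots> < card ?S"
    using in_top(1) by (intro psubset_card_mono) auto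
  also have "card ?S = m"
    by (rule card_top_set) fact
  finally show False
    using many by simp
qed

lemma card_above_un_top_set_less:
  assumes "m \<le> k" "g \<le> k" and low_in_top: "i \<in> top_set m k f" "f i \<le> w"
    and high_outside: "g \<le> j" "j < k" "w < f j"
  shows "card ({l. l < g \<and> w < f l} \<union> top_set m k f \<inter> {..<g}) < m"
proof -
  have above: "l \<in> top_set m k f" if "l < k" "w < f l" for l
    using top_set_beats[OF low_in_top(1) _ that(1)] that(2) low_in_top(2) by force
  have "{l. l < g \<and> w < f l} \<union> top_set m k f \<inter> {..<g} \<subseteq> top_set m k f - {j}"
    using above high_outside(1) \<open>g \<le> k\<close> by auto
  then have "{l. l < g \<and> w < f l} \<union> top_set m k f \<inter> {..<g} \<subset> top_set m k f"
    using above[OF high_outside(2,3)] by blast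
  from psubset_card_mono[OF _ this] show ?thesis
    using \<open>m \<le> k\<close> by (simp add: card_top_set)
qed

section \<open>Dynamics of the greedy phase\<close>

definition running_mean :: "(nat \<Rightarrow> real) \<Rightarrow> nat \<Rightarrow> real" where
  "running_mean x n = (\<Sum>j<n. x j) / real n"

definition exceed_count :: "real \<Rightarrow> nat set \<Rightarrow> (nat \<Rightarrow> real) \<Rightarrow> nat" where
  "exceed_count a A x = card {n \<in> A. a \<le> running_mean x n}"

declare efg_counts.simps(2) [simp del]

context
  fixes m k n0 :: nat and X :: "nat \<times> nat \<Rightarrow> real"
begin

abbreviation (input) counts :: "nat \<Rightarrow> nat \<Rightarrow> nat" where
  "counts \<equiv> efg_counts m k n0 X"

definition efg_mean :: "nat \<Rightarrow> nat \<Rightarrow> real" where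
  "efg_mean t i = running_mean (curry X i) (counts t i)"

definition efg_set :: "nat \<Rightarrow> nat set" where
  "efg_set t = top_set m k (efg_mean t)"

lemma sample_mean_efg_counts: "sample_mean X (counts t) = efg_mean t"
  by (simp add: fun_eq_iff efg_mean_def sample_mean_def running_mean_def)

lemma efg_counts_Suc:
  "counts (Suc t) i = (if i \<in> efg_set t then Suc (counts t i) else counts t i)"
  by (simp add: efg_counts.simps(2) Let_def efg_set_def sample_mean_efg_counts)

lemma efg_counts_mono: "s \<le> t \<Longrightarrow> counts s i \<le> counts t i"
  by (induction t rule: dec_induct) (auto simp: efg_counts_Suc)

lemma efg_counts_ge: "n0 \<le> counts t i"
  using efg_counts_mono[of 0 t] by simp

lemma efg_counts_le: "counts t i \<le> n0 + t"
  by (induction t) (auto simp: efg_counts_Suc)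

lemma efg_counts_inj:
  assumes "i \<in> efg_set s" "i \<in> efg_set t" "counts s i = counts t i"
  shows "s = t"
proof -
  have less: "counts s i < counts t i" if "s < t" "i \<in> efg_set s" for s t
    using efg_counts_mono[of "Suc s" t i] that by (simp add: efg_counts_Suc)
  show ?thesis
    using less[of s t] less[of t s] assms by (cases s t rule: linorder_cases) auto
qed

lemma efg_counts_sampled_at:
  assumes "n0 \<le> n" "n < counts t i"
  obtains s where "s < t" "i \<in> efg_set s" "counts s i = n"
  using assms
proof (induction t arbitrary: thesis)
  case (Suc t)
  then show ?case
    by (metis efg_counts_Suc less_Suc_eq)
qed simp

lemma efg_mean_Suc: "i \<notin> efg_set t \<Longrightarrow> efg_mean (Suc t) i = efg_mean t i"
  by (simp add: efg_mean_def efg_counts_Suc)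

lemma efg_set_subset: "efg_set t \<subseteq> {..<k}"
  unfolding efg_set_def by (rule top_set_subset)

lemma finite_efg_set [simp]: "finite (efg_set t)"
  by (simp add: efg_set_def)

lemma card_efg_set: "m \<le> k \<Longrightarrow> card (efg_set t) = m"
  by (simp add: efg_set_def card_top_set)

lemma sum_efg_counts:
  assumes "m \<le> k"
  shows "(\<Sum>i<k. counts t i) = n0 * k + m * t"
proof (induction t)
  case (Suc t)
  have "(\<Sum>i<k. counts (Suc t) i) = (\<Sum>i<k. counts t i + (if i \<in> efg_set t then 1 else 0))"
    by (intro sum.cong) (auto simp: efg_counts_Suc)
  also have "\<dots> = (\<Sum>i<k. counts t i) + card (efg_set t)"
    using efg_set_subset by (simp add: sum.distrib sum.If_cases Int_absorb1)
  finally show ?case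
    using Suc card_efg_set[OF assms] by simp
qed simp

lemma efg_rounds_eq: "m \<le> k \<Longrightarrow> efg_rounds m k n0 B X = (LEAST t. B \<le> n0 * k + m * t)"
  by (simp add: efg_rounds_def sum_efg_counts not_less)

lemma
  assumes "0 < m" "m \<le> k"
  shows efg_rounds_le: "efg_rounds m k n0 B X \<le> B"
    and budget_le_efg_rounds: "B \<le> n0 * k + m * efg_rounds m k n0 B X"
proof -
  have "B \<le> n0 * k + m * B"
    using assms(1) by (simp add: trans_le_add2)
  then show "efg_rounds m k n0 B X \<le> B" "B \<le> n0 * k + m * efg_rounds m k n0 B X"
    unfolding efg_rounds_eq[OF assms(2)] by (rule Least_le, rule LeastI)
qed

lemma efg_output_eq: "efg_output m k n0 B X = efg_set (efg_rounds m k n0 B X)"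
  by (simp add: efg_output_def efg_set_def sample_mean_efg_counts)

lemma card_rounds_le:
  assumes "finite A" "\<And>i. i \<in> A \<Longrightarrow> finite (C i)"
    and "\<And>t. t \<in> R \<Longrightarrow> \<exists>i\<in>A. i \<in> efg_set t \<and> counts t i \<in> C i"
  shows "card R \<le> (\<Sum>i\<in>A. card (C i))"
proof -
  obtain h where choice: "h t \<in> A" "h t \<in> efg_set t" "counts t (h t) \<in> C (h t)" if "t \<in> R" for t
    using assms(3) by metis
  have "inj_on (\<lambda>t. (h t, counts t (h t))) R"
    by (rule inj_onI) (metis Pair_inject efg_counts_inj choice(2))
  moreover have "(\<lambda>t. (h t, counts t (h t))) ` R \<subseteq> Sigma A C"
    using choice by auto
  ultimately have "card R \<le> card (Sigma A C)"
    by (rule card_inj_on_le) (use assms in auto)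
  then show ?thesis
    using assms by simp
qed

lemma card_bad_rounds_le:
  assumes "m \<le> g" "g \<le> k"
    and top: "\<And>i n. i < m \<Longrightarrow> n \<in> {n0..<n0 + T} \<Longrightarrow> b \<le> running_mean (curry X i) n"
  shows "card {t. t < T \<and> \<not> efg_set t \<subseteq> {..<g}}
    \<le> (\<Sum>i\<in>{g..<k}. exceed_count b {n0..<n0 + T} (curry X i))"
  unfolding exceed_count_def
proof (rule card_rounds_le)
  fix t assume "t \<in> {t. t < T \<and> \<not> efg_set t \<subseteq> {..<g}}"
  then obtain i where t_less: "t < T" and sampled: "i \<in> efg_set t" "g \<le> i"
    by (force simp: subset_eq not_less)
  have count: "counts t l \<in> {n0..<n0 + T}" for l
    using efg_counts_ge[of t l] efg_counts_le[of t l] t_less by simp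
  have "\<not> {..<m} \<subseteq> efg_set t"
  proof
    assume "{..<m} \<subseteq> efg_set t"
    moreover have "i \<notin> {..<m}"
      using sampled(2) \<open>m \<le> g\<close> by simp
    ultimately have "{..<m} \<subset> efg_set t"
      using sampled(1) by blast
    from psubset_card_mono[OF _ this] show False
      using assms by (simp add: card_efg_set)
  qed
  then obtain j where unsampled: "j < m" "j \<notin> efg_set t"
    by auto
  then have "b \<le> efg_mean t j"
    using top count by (simp add: efg_mean_def)
  also have "\<dots> \<le> efg_mean t i"
    using top_set_beats[of i m k "efg_mean t" j] sampled(1) unsampled assms by (auto simp: efg_set_def)
  finally have "b \<le> running_mean (curry X i) (counts t i)"
    by (simp add: efg_mean_def)
  moreover have "i \<in> {g..<k}"
    using sampled efg_set_subset by auto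
  ultimately show "\<exists>i\<in>{g..<k}. i \<in> efg_set t \<and>
      counts t i \<in> {n \<in> {n0..<n0 + T}. b \<le> running_mean (curry X i) n}"
    using sampled(1) count by auto
qed auto

lemma bad_mean_above_before_bad_round:
  assumes "m \<le> k" "g \<le> k" and many: "\<And>s. s \<le> T \<Longrightarrow> m \<le> card {i. i < g \<and> w \<le> efg_mean s i}"
    and bad: "\<not> efg_set T \<subseteq> {..<g}" and "t \<le> T"
  obtains j where "g \<le> j" "j < k" "w < efg_mean t j"
proof (rule ccontr)
  assume "\<not> thesis"
  then have low: "\<forall>i. g \<le> i \<and> i < k \<longrightarrow> efg_mean t i \<le> w"
    using that by (meson not_le)
  have "\<forall>i. g \<le> i \<and> i < k \<longrightarrow> efg_mean s i \<le> w" if "t \<le> s" "s \<le> T" for s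
    using that
  proof (induction s rule: dec_induct)
    case (step s)
    then have "efg_set s \<subseteq> {..<g}"
      unfolding efg_set_def using assms many[of s] by (intro top_set_subset_lessThan[where w = w]) auto
    then have "efg_mean (Suc s) i = efg_mean s i" if "g \<le> i" for i
      using that by (intro efg_mean_Suc) auto
    with step show ?case
      by simp
  qed (rule low)
  then have "efg_set T \<subseteq> {..<g}"
    unfolding efg_set_def using assms many[of T] by (intro top_set_subset_lessThan[where w = w]) auto
  with bad show False ..
qed

lemma few_good_means_above_persists:
  assumes "m \<le> k" "g \<le> k"
    and high: "\<And>t. t \<le> T \<Longrightarrow> \<exists>j\<ge>g. j < k \<and> w < efg_mean t j"
    and few: "card {i. i < g \<and> w < efg_mean s i} < m" and "s \<le> t" "t \<le> T"
  shows "card {i. i < g \<and> w < efg_mean t i} < m"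
  using \<open>s \<le> t\<close> \<open>t \<le> T\<close>
proof (induction t rule: dec_induct)
  case (step t)
  let ?above = "\<lambda>t. {i. i < g \<and> w < efg_mean t i}"
  have "card (?above t \<union> efg_set t \<inter> {..<g}) < m"
  proof (cases "\<exists>i\<in>efg_set t. efg_mean t i \<le> w")
    case True
    moreover obtain j where "g \<le> j" "j < k" "w < efg_mean t j"
      using high[of t] step.prems by auto
    ultimately show ?thesis
      using card_above_un_top_set_less[OF assms(1,2), of _ "efg_mean t" w j] by (auto simp: efg_set_def)
  next
    case False
    then have "?above t \<union> efg_set t \<inter> {..<g} = ?above t"
      by force
    with step show ?thesis by simp
  qed
  moreover have "?above (Suc t) \<subseteq> ?above t \<union> efg_set t \<inter> {..<g}"
    by (auto simp: efg_mean_Suc)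
  then have "card (?above (Suc t)) \<le> card (?above t \<union> efg_set t \<inter> {..<g})"
    by (rule card_mono[rotated]) simp
  ultimately show ?case
    by simp
qed (rule few)

lemma no_good_round_after_low_mean_sampled:
  assumes "m \<le> k" "g \<le> k"
    and high: "\<And>t. t \<le> T \<Longrightarrow> \<exists>j\<ge>g. j < k \<and> w < efg_mean t j"
    and low_sampled: "i \<in> efg_set s" "efg_mean s i \<le> w" and "s \<le> t" "t \<le> T"
  shows "\<not> efg_set t \<subseteq> {..<g}"
proof
  let ?above = "\<lambda>t. {l. l < g \<and> w < efg_mean t l}"
  obtain j where "g \<le> j" "j < k" "w < efg_mean s j"
    using high[of s] \<open>s \<le> t\<close> \<open>t \<le> T\<close> by auto
  then have "card (?above s \<union> efg_set s \<inter> {..<g}) < m"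
    using card_above_un_top_set_less[OF \<open>m \<le> k\<close> \<open>g \<le> k\<close>] low_sampled unfolding efg_set_def by blast
  then have "card (?above s) < m"
    by (rule le_less_trans[rotated]) (auto intro!: card_mono)
  then have few: "card (?above t) < m"
    using few_good_means_above_persists[OF \<open>m \<le> k\<close> \<open>g \<le> k\<close>, of T w s t] high \<open>s \<le> t\<close> \<open>t \<le> T\<close>
    by blast
  assume good: "efg_set t \<subseteq> {..<g}"
  obtain j where "g \<le> j" "j < k" "w < efg_mean t j"
    using high[OF \<open>t \<le> T\<close>] by auto
  then have "efg_set t \<subseteq> ?above t"
    using top_set_beats[of _ m k "efg_mean t" j] good unfolding efg_set_def by fastforce
  then have "card (efg_set t) \<le> card (?above t)"
    by (intro card_mono) auto
  with few show False
    using \<open>m \<le> k\<close> by (simp add: card_efg_set)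
qed

lemma counts_less_in_good_round:
  assumes "m \<le> k" "g \<le> k"
    and high: "\<And>t. t \<le> T \<Longrightarrow> \<exists>j\<ge>g. j < k \<and> w < efg_mean t j"
    and good: "efg_set t \<subseteq> {..<g}" and "t \<le> T"
    and sampled: "i \<in> efg_set t" and low_minimum: "n0 \<le> p" "running_mean (curry X i) p \<le> w"
  shows "counts t i < p"
proof (rule ccontr)
  assume "\<not> ?thesis"
  then have "p < counts (Suc t) i"
    using sampled by (simp add: efg_counts_Suc)
  then obtain s where earlier: "s < Suc t" "i \<in> efg_set s" "counts s i = p"
    using efg_counts_sampled_at low_minimum(1) by blast
  then have "efg_mean s i \<le> w"
    using low_minimum(2) by (simp add: efg_mean_def)
  then have "\<not> efg_set t \<subseteq> {..<g}"
    using earlier(1) \<open>t \<le> T\<close>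
    by (intro no_good_round_after_low_mean_sampled[OF \<open>m \<le> k\<close> \<open>g \<le> k\<close> high earlier(2)]) auto
  with good show False
    by contradiction
qed

lemma card_good_rounds_le:
  assumes "0 < m" "m \<le> g" "g \<le> k" "n0 \<le> L"
    and early: "\<And>i n. i < g \<Longrightarrow> n \<in> {n0..n0 + T} \<Longrightarrow>
      \<exists>p\<in>{n0..L}. running_mean (curry X i) p \<le> running_mean (curry X i) n"
    and bad: "\<not> efg_set T \<subseteq> {..<g}"
  shows "card {t. t < T \<and> efg_set t \<subseteq> {..<g}} \<le> g * (L - n0)"
proof -
  have "m \<le> k"
    using assms by simp
  define least where "least i = Min (running_mean (curry X i) ` {n0..L})" for i
  have least_le: "least i \<le> efg_mean t i" if in_range: "i < g" "t \<le> T" for i t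
  proof -
    have "counts t i \<in> {n0..n0 + T}"
      using efg_counts_ge[of t i] efg_counts_le[of t i] in_range(2) by simp
    from early[OF in_range(1) this] show ?thesis
      unfolding least_def efg_mean_def by (intro Min_le_iff[THEN iffD2]) auto
  qed
  obtain w where few: "card {i. i < g \<and> least i > w} < m" and many: "m \<le> card {i. i < g \<and> least i \<ge> w}"
    using top_set_threshold_exists[OF \<open>0 < m\<close> \<open>m \<le> g\<close>] by blast
  have "m \<le> card {i. i < g \<and> w \<le> efg_mean t i}" if "t \<le> T" for t
    using many least_le[OF _ that] by (elim order_trans, intro card_mono) force+
  then have high: "\<exists>j\<ge>g. j < k \<and> w < efg_mean t j" if "t \<le> T" for t
    using bad_mean_above_before_bad_round[OF \<open>m \<le> k\<close> \<open>g \<le> k\<close> _ bad that] by metis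
  have "card {t. t < T \<and> efg_set t \<subseteq> {..<g}} \<le> (\<Sum>i<g. card {n0..<L})"
  proof (rule card_rounds_le)
    fix t assume "t \<in> {t. t < T \<and> efg_set t \<subseteq> {..<g}}"
    then have good_round: "t \<le> T" "efg_set t \<subseteq> {..<g}" by auto
    have "\<not> efg_set t \<subseteq> {i. i < g \<and> least i > w}"
      using card_mono[of "{i. i < g \<and> least i > w}" "efg_set t"] few \<open>m \<le> k\<close> by (auto simp: card_efg_set)
    then obtain i where sampled: "i \<in> efg_set t" "least i \<le> w"
      using good_round(2) by fastforce
    moreover have "least i \<in> running_mean (curry X i) ` {n0..L}"
      unfolding least_def using \<open>n0 \<le> L\<close> by (intro Min_in) auto
    ultimately obtain p where minimum: "p \<in> {n0..L}" "running_mean (curry X i) p \<le> w"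
      by (metis imageE)
    then have "counts t i < p"
      using counts_less_in_good_round[OF \<open>m \<le> k\<close> \<open>g \<le> k\<close> high good_round(2,1) sampled(1)] by simp
    then show "\<exists>i\<in>{..<g}. i \<in> efg_set t \<and> counts t i \<in> {n0..<L}"
      using sampled(1) minimum(1) good_round(2) efg_counts_ge by (intro bexI[of _ i]) auto
  qed auto
  then show ?thesis
    by simp
qed

lemma efg_set_subset_lessThan:
  assumes "0 < m" "m \<le> g" "g \<le> k" "n0 \<le> L"
    and "\<And>i n. i < m \<Longrightarrow> n \<in> {n0..<n0 + T} \<Longrightarrow> b \<le> running_mean (curry X i) n"
    and "\<And>i n. i < g \<Longrightarrow> n \<in> {n0..n0 + T} \<Longrightarrow>
      \<exists>p\<in>{n0..L}. running_mean (curry X i) p \<le> running_mean (curry X i) n"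
    and few: "g * L + (\<Sum>i\<in>{g..<k}. exceed_count b {n0..<n0 + T} (curry X i)) < T"
  shows "efg_set T \<subseteq> {..<g}"
proof (rule ccontr)
  let ?good = "{t. t < T \<and> efg_set t \<subseteq> {..<g}}" and ?bad = "{t. t < T \<and> \<not> efg_set t \<subseteq> {..<g}}"
  assume "\<not> ?thesis"
  then have "card ?good \<le> g * (L - n0)"
    using assms by (intro card_good_rounds_le) auto
  also have "\<dots> \<le> g * L"
    by simp
  finally have "card ?good \<le> g * L" .
  moreover have "card ?bad \<le> (\<Sum>i\<in>{g..<k}. exceed_count b {n0..<n0 + T} (curry X i))"
    using assms by (intro card_bad_rounds_le) auto
  moreover have "T = card (?good \<union> ?bad)"
    by (rule trans[OF card_lessThan[symmetric]], rule arg_cong[where f = card]) auto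
  then have "T = card ?good + card ?bad"
    by (subst (asm) card_Un_disjoint) auto
  ultimately show False
    using few by simp
qed

end

section \<open>Running means of standard normal sequences\<close>

lemma (in sequence_space) emeasure_eq_nn_integral_case_nat:
  assumes [measurable]: "Measurable.pred S P"
  shows "emeasure S {x \<in> space S. P x} = (\<integral>\<^sup>+ y. emeasure S {x \<in> space S. P (case_nat y x)} \<partial>M)"
proof -
  let ?f = "\<lambda>(y, x). case_nat y x"
  have "emeasure S {x \<in> space S. P x} = emeasure (M \<Otimes>\<^sub>M S) (?f -` {x \<in> space S. P x} \<inter> space (M \<Otimes>\<^sub>M S))"
    using emeasure_distr[of ?f "M \<Otimes>\<^sub>M S" S "{x \<in> space S. P x}"] by (simp add: PiM_iter)
  also have "\<dots> = (\<integral>\<^sup>+ y. emeasure S (Pair y -` (?f -` {x \<in> space S. P x} \<inter> space (M \<Otimes>\<^sub>M S))) \<partial>M)"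
    by (rule P.emeasure_pair_measure_alt) measurable
  also have "\<dots> = (\<integral>\<^sup>+ y. emeasure S {x \<in> space S. P (case_nat y x)} \<partial>M)"
    by (intro nn_integral_cong arg_cong[where f = "emeasure S"])
      (auto simp: space_pair_measure space_PiM PiE_iff split: nat.split)
  finally show ?thesis .
qed

text \<open>Peeling off the first factor \<open>h (x 0)\<close> of the product multiplies \<open>z\<close> by it.\<close>

lemma (in sequence_space) emeasure_prod_ge_finite_le:
  fixes h :: "'a \<Rightarrow> ennreal"
  assumes [measurable]: "h \<in> borel_measurable M" and mean: "(\<integral>\<^sup>+ y. h y \<partial>M) \<le> 1"
    and c_bounds: "0 < c" "c < \<top>"
  shows "emeasure S {x \<in> space S. \<exists>n<N. c \<le> z * (\<Prod>j<n. h (x j))} \<le> z / c"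
proof (induction N arbitrary: z)
  case (Suc N)
  let ?hit = "\<lambda>N z x. \<exists>n<N. c \<le> z * (\<Prod>j<n. h (x j))"
  show ?case
  proof (cases "c \<le> z")
    case True
    have "emeasure S {x \<in> space S. ?hit (Suc N) z x} \<le> c / c"
      using c_bounds P.emeasure_le_1 by (simp add: ennreal_divide_self less_top)
    also have "\<dots> \<le> z / c"
      using True by (rule divide_right_mono_ennreal)
    finally show ?thesis .
  next
    case False
    have shift: "?hit (Suc N) z (case_nat y x) \<longleftrightarrow> ?hit N (z * h y) x" for y x
      using False by (simp add: Ex_less_Suc2 prod.lessThan_Suc_shift mult.assoc del: prod.lessThan_Suc)
    have "emeasure S {x \<in> space S. ?hit (Suc N) z x}
        = (\<integral>\<^sup>+ y. emeasure S {x \<in> space S. ?hit N (z * h y) x} \<partial>M)"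
      unfolding shift[symmetric] by (rule emeasure_eq_nn_integral_case_nat) measurable
    also have "\<dots> \<le> (\<integral>\<^sup>+ y. z / c * h y \<partial>M)"
      by (intro nn_integral_mono order_trans[OF Suc]) (simp add: ennreal_times_divide mult_ac)
    also have "\<dots> = z / c * (\<integral>\<^sup>+ y. h y \<partial>M)"
      by (rule nn_integral_cmult) simp
    also have "\<dots> \<le> z / c"
      using mult_left_mono[OF mean, of "z / c"] by simp
    finally show ?thesis .
  qed
qed simp

lemma (in sequence_space) ville_inequality:
  fixes h :: "'a \<Rightarrow> ennreal"
  assumes [measurable]: "h \<in> borel_measurable M" and "(\<integral>\<^sup>+ y. h y \<partial>M) \<le> 1"
    and "0 < c" "c < \<top>"
  shows "emeasure S {x \<in> space S. \<exists>n. c \<le> (\<Prod>j<n. h (x j))} \<le> 1 / c"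
proof -
  let ?A = "\<lambda>N. {x \<in> space S. \<exists>n<N. c \<le> (\<Prod>j<n. h (x j))}"
  have "{x \<in> space S. \<exists>n. c \<le> (\<Prod>j<n. h (x j))} = (\<Union>N. ?A N)"
    by auto
  also have "emeasure S \<dots> = (SUP N. emeasure S (?A N))"
    by (intro SUP_emeasure_incseq[symmetric]) (auto simp: incseq_def intro: less_le_trans)
  also have "\<dots> \<le> 1 / c"
    using emeasure_prod_ge_finite_le[OF assms, of _ 1] by (intro SUP_least) simp
  finally show ?thesis .
qed

lemma (in sequence_space) prob_comb_seq_le:
  assumes [measurable]: "Measurable.pred S E" "Measurable.pred S A"
      "Measurable.pred S B" "Measurable.pred S C"
    and cover: "\<And>x y. E (comb_seq i x y) \<Longrightarrow> A x \<and> B y \<or> C x"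
  shows "\<P>(x in S. E x) \<le> \<P>(x in S. A x) * \<P>(y in S. B y) + \<P>(x in S. C x)"
proof -
  let ?f = "\<lambda>(x, y). comb_seq i x y"
  let ?E = "{x \<in> space S. E x}" and ?A = "{x \<in> space S. A x}"
    and ?B = "{y \<in> space S. B y}" and ?C = "{x \<in> space S. C x}"
  have "emeasure S ?E = emeasure (S \<Otimes>\<^sub>M S) (?f -` ?E \<inter> space (S \<Otimes>\<^sub>M S))"
    using emeasure_distr[of ?f "S \<Otimes>\<^sub>M S" S ?E] by (simp add: PiM_comb_seq measurable_comb_seq)
  also have "\<dots> \<le> emeasure (S \<Otimes>\<^sub>M S) (?A \<times> ?B \<union> ?C \<times> space S)"
    using cover by (intro emeasure_mono) (auto simp: space_pair_measure)
  also have "\<dots> \<le> emeasure (S \<Otimes>\<^sub>M S) (?A \<times> ?B) + emeasure (S \<Otimes>\<^sub>M S) (?C \<times> space S)"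
    by (rule emeasure_subadditive) measurable
  also have "\<dots> = emeasure S ?A * emeasure S ?B + emeasure S ?C"
    by (simp add: P.emeasure_pair_measure_Times P.emeasure_space_1)
  also have "\<dots> = ennreal (P.prob ?A * P.prob ?B + P.prob ?C)"
    by (simp add: P.emeasure_eq_measure flip: ennreal_mult ennreal_plus)
  finally show ?thesis
    unfolding P.emeasure_eq_measure by (subst (asm) ennreal_le_iff) auto
qed

abbreviation std_normal :: "real measure" where
  "std_normal \<equiv> density lborel (\<lambda>x. ennreal (std_normal_density x))"

definition gauss_seq :: "(nat \<Rightarrow> real) measure" where
  "gauss_seq = PiM UNIV (\<lambda>_. std_normal)"

interpretation std_normal: prob_space std_normal
  by (rule prob_space_normal_density) simp

interpretation gauss_seq: prob_space gauss_seq
  unfolding gauss_seq_def by (intro prob_space_PiM std_normal.prob_space_axioms)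

interpretation std_normal_sequence: sequence_space std_normal
  rewrites "PiM UNIV (\<lambda>_. std_normal) = gauss_seq"
  by (simp_all add: sequence_space_def product_prob_spaceI std_normal.prob_space_axioms gauss_seq_def)

lemma measurable_gauss_seq [measurable]: "(\<lambda>x. x j) \<in> borel_measurable gauss_seq"
  unfolding gauss_seq_def by measurable

lemma measurable_running_mean [measurable (raw)]:
  assumes [measurable]: "\<And>j. (\<lambda>w. x w j) \<in> borel_measurable M"
  shows "(\<lambda>w. running_mean (x w) n) \<in> borel_measurable M"
  unfolding running_mean_def by measurable

definition gauss_tail :: "real \<Rightarrow> real" where
  "gauss_tail a = exp (- (a\<^sup>2 / 2))"

lemma gauss_tail_pos [simp]: "0 < gauss_tail a"
  by (simp add: gauss_tail_def)

lemma gauss_tail_less_one_iff [simp]: "gauss_tail a < 1 \<longleftrightarrow> a \<noteq> 0"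
  by (simp add: gauss_tail_def)

lemma gauss_tail_minus [simp]: "gauss_tail (- a) = gauss_tail a"
  by (simp add: gauss_tail_def)

lemma nn_integral_exp_std_normal:
  "(\<integral>\<^sup>+ y. ennreal (exp (a * y - a\<^sup>2 / 2)) \<partial>std_normal) = 1"
proof -
  have "std_normal_density y * exp (a * y - a\<^sup>2 / 2) = normal_density a 1 y" for y
    by (simp add: normal_density_def mult_exp_exp power2_eq_square field_simps)
  then have "(\<integral>\<^sup>+ y. ennreal (exp (a * y - a\<^sup>2 / 2)) \<partial>std_normal)
      = (\<integral>\<^sup>+ y. ennreal (normal_density a 1 y) \<partial>lborel)"
    by (subst nn_integral_density) (auto simp flip: ennreal_mult)
  also have "\<dots> = 1"
    by (subst nn_integral_eq_integral) auto
  finally show ?thesis .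
qed

lemma prob_gauss_seq_mean_maximal:
  assumes "1 \<le> l"
  shows "\<P>(x in gauss_seq. \<exists>n\<ge>l. a\<^sup>2 \<le> a * running_mean x n) \<le> gauss_tail a ^ l"
proof -
  let ?h = "\<lambda>y. ennreal (exp (a * y - a\<^sup>2 / 2))" and ?c = "exp (a\<^sup>2 / 2) ^ l"
  have "ennreal ?c \<le> (\<Prod>j<n. ?h (x j))" if exceeds: "l \<le> n" "a\<^sup>2 \<le> a * running_mean x n" for x n
  proof -
    have "real l * a\<^sup>2 \<le> real n * a\<^sup>2"
      using exceeds(1) by (intro mult_right_mono) auto
    moreover have "real n * a\<^sup>2 \<le> real n * (a * running_mean x n)"
      using exceeds(2) by (intro mult_left_mono) auto
    moreover have "real n * (a * running_mean x n) = a * (\<Sum>j<n. x j)"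
      using exceeds(1) assms by (simp add: running_mean_def)
    ultimately have "exp (real l * (a\<^sup>2 / 2)) \<le> exp (\<Sum>j<n. a * x j - a\<^sup>2 / 2)"
      by (simp add: sum_subtractf flip: sum_distrib_left)
    then show ?thesis
      by (simp only: exp_of_nat_mult exp_sum finite_lessThan prod_ennreal exp_ge_zero ennreal_leI)
  qed
  then have "emeasure gauss_seq {x \<in> space gauss_seq. \<exists>n\<ge>l. a\<^sup>2 \<le> a * running_mean x n}
      \<le> emeasure gauss_seq {x \<in> space gauss_seq. \<exists>n. ennreal ?c \<le> (\<Prod>j<n. ?h (x j))}"
    by (intro emeasure_mono) auto
  also have "\<dots> \<le> 1 / ennreal ?c"
    by (rule std_normal_sequence.ville_inequality) (auto simp: nn_integral_exp_std_normal)
  also have "\<dots> = ennreal (gauss_tail a ^ l)"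
    by (simp add: gauss_tail_def exp_minus power_inverse inverse_ennreal divide_ennreal_def)
  finally show ?thesis
    by (simp add: gauss_seq.emeasure_eq_measure less_imp_le)
qed

lemma prob_gauss_seq_mean_ge:
  assumes "0 < a" "1 \<le> l"
  shows "\<P>(x in gauss_seq. \<exists>n\<ge>l. a \<le> running_mean x n) \<le> gauss_tail a ^ l"
  using prob_gauss_seq_mean_maximal[OF assms(2), of a] assms(1) by (simp add: power2_eq_square)

lemma prob_gauss_seq_mean_le:
  assumes "0 < a" "1 \<le> l"
  shows "\<P>(x in gauss_seq. \<exists>n\<ge>l. running_mean x n \<le> - a) \<le> gauss_tail a ^ l"
proof -
  have "(- a)\<^sup>2 \<le> - a * r \<longleftrightarrow> r \<le> - a" for r
    using assms(1) mult_le_cancel_left_pos[of a r "- a"] by (auto simp: power2_eq_square)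
  then show ?thesis
    using prob_gauss_seq_mean_maximal[OF assms(2), of "- a"] by simp
qed

lemma indep_vars_PiM_components:
  assumes "I \<noteq> {}" and prob: "\<And>i. i \<in> I \<Longrightarrow> prob_space (M i)"
  shows "prob_space.indep_vars (PiM I M) M (\<lambda>i x. x i) I"
proof -
  interpret prob_space "PiM I M" by (intro prob_space_PiM prob)
  have "distr (PiM I M) (PiM I M) (\<lambda>x. \<lambda>i\<in>I. x i) = distr (PiM I M) (PiM I M) (\<lambda>x. x)"
    by (rule distr_cong) (simp_all add: space_PiM PiE_restrict)
  also have "\<dots> = PiM I (\<lambda>i. distr (PiM I M) (M i) (\<lambda>x. x i))"
    by (simp add: distr_id distr_PiM_component prob cong: PiM_cong)
  finally show ?thesis
    by (subst indep_vars_iff_distr_eq_PiM') (simp_all add: assms(1))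
qed

lemma distributed_PiM_component:
  assumes "\<And>i. i \<in> I \<Longrightarrow> prob_space (M i)" "i \<in> I" and density: "M i = density lborel f"
    and [measurable]: "f \<in> borel_measurable borel"
  shows "distributed (PiM I M) lborel (\<lambda>x. x i) f"
proof -
  have "distr (PiM I M) (M i) (\<lambda>x. x i) = M i"
    using assms(1,2) by (rule distr_PiM_component)
  moreover have "distr (PiM I M) (M i) (\<lambda>x. x i) = distr (PiM I M) lborel (\<lambda>x. x i)"
    by (rule distr_cong) (simp_all add: density)
  moreover have "(\<lambda>x. x i) \<in> borel_measurable (PiM I M)"
    using measurable_component_singleton[OF assms(2), of M] by (simp add: density)
  ultimately show ?thesis
    by (simp add: distributed_def density)
qed

lemma distributed_gauss_seq_sum:
  assumes "0 < n"
  shows "distributed gauss_seq lborel (\<lambda>x. \<Sum>j<n. x j) (normal_density 0 (sqrt (real n)))"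
proof -
  have "gauss_seq.indep_vars (\<lambda>_. std_normal) (\<lambda>j x. x j) UNIV"
    unfolding gauss_seq_def by (intro indep_vars_PiM_components std_normal.prob_space_axioms) simp
  then have "gauss_seq.indep_vars (\<lambda>_. borel) (\<lambda>j x. x j) UNIV"
    by (rule gauss_seq.indep_vars_compose2[where Y = "\<lambda>_ y. y"]) simp
  then have indep: "gauss_seq.indep_vars (\<lambda>_. borel) (\<lambda>j x. x j) {..<n}"
    by (rule gauss_seq.indep_vars_subset) simp
  have "distributed gauss_seq lborel (\<lambda>x. x j) std_normal_density" for j
    unfolding gauss_seq_def by (rule distributed_PiM_component) (simp_all add: std_normal.prob_space_axioms)
  then have "distributed gauss_seq lborel (\<lambda>x. \<Sum>j<n. x j) (normal_density (\<Sum>j<n. 0) (sqrt (\<Sum>j<n. 1\<^sup>2)))"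
    using assms indep by (intro gauss_seq.sum_indep_normal) auto
  then show ?thesis
    by simp
qed

lemma measure_std_normal_less_neg_one_pos: "0 < measure std_normal {..<-1}"
proof -
  have "{..<-1} \<notin> null_sets std_normal"
  proof
    assume "{..<-1} \<in> null_sets std_normal"
    then have "AE x in lborel. x \<notin> {..<-1::real}"
      using normal_density_pos[of 1 0] by (simp add: null_sets_density_iff not_less less_le)
    then have "{..<-1::real} \<in> null_sets lborel"
      by (simp add: AE_iff_null_sets)
    then have "{-2<..<-1::real} \<in> null_sets lborel"
      by (rule null_sets_subset) auto
    then show False
      by (simp add: null_sets_def)
  qed
  then show ?thesis
    by (simp add: null_sets_def std_normal.emeasure_eq_measure zero_less_measure_iff)
qed

lemma prob_gauss_seq_sum_ge:
  assumes "0 < n"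
  shows "\<P>(x in gauss_seq. - sqrt (real n) \<le> (\<Sum>j<n. x j))
    = 1 - measure std_normal {..<-1}"
proof -
  have sqrt_pos: "0 < sqrt (real n)"
    using assms by simp
  have "distributed gauss_seq lborel (\<lambda>x. ((\<Sum>j<n. x j) - 0) / sqrt (real n)) std_normal_density"
    using distributed_gauss_seq_sum[OF assms]
      gauss_seq.normal_standard_normal_convert[OF sqrt_pos, of "\<lambda>x. \<Sum>j<n. x j" 0] by simp
  then have distr: "distr gauss_seq lborel (\<lambda>x. (\<Sum>j<n. x j) / sqrt (real n)) = std_normal"
    by (simp add: distributed_def)
  have "{x \<in> space gauss_seq. - sqrt (real n) \<le> (\<Sum>j<n. x j)}
      = (\<lambda>x. (\<Sum>j<n. x j) / sqrt (real n)) -` {-1..} \<inter> space gauss_seq"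
    using sqrt_pos by (auto simp: field_simps)
  then have "\<P>(x in gauss_seq. - sqrt (real n) \<le> (\<Sum>j<n. x j))
      = measure (distr gauss_seq lborel (\<lambda>x. (\<Sum>j<n. x j) / sqrt (real n))) {-1..}"
    by (subst measure_distr) auto
  also have "\<dots> = measure std_normal (space std_normal - {..<-1})"
    unfolding distr by (rule arg_cong[where f = "measure std_normal"]) auto
  also have "\<dots> = 1 - measure std_normal {..<-1}"
    by (rule std_normal.prob_compl) simp
  finally show ?thesis .
qed

lemma sum_comb_seq:
  fixes x y :: "nat \<Rightarrow> 'a :: comm_monoid_add"
  shows "(\<Sum>j<u + n. comb_seq u x y j) = (\<Sum>j<u. x j) + (\<Sum>j<n. y j)"
proof (induction n)
  case 0
  show ?case
    by (auto intro: sum.cong simp: comb_seq_less)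
next
  case (Suc n)
  then show ?case
    using comb_seq_add[of u x y n] by (simp add: add_ac)
qed

text \<open>A further block of length \<open>(c + 1)\<^sup>2\<close> has a sum below \<open>- (c + 1)\<close> with a probability that does
  not depend on \<open>c\<close>.\<close>

lemma prob_gauss_seq_sums_nonneg_le:
  assumes "l \<le> u"
  shows "\<P>(x in gauss_seq. \<forall>n\<ge>l. 0 \<le> (\<Sum>j<n. x j))
    \<le> \<P>(x in gauss_seq. \<forall>n\<in>{l..u}. 0 \<le> (\<Sum>j<n. x j)) * (1 - measure std_normal {..<-1})
      + \<P>(x in gauss_seq. real c < (\<Sum>j<u. x j))"
proof -
  let ?r = "(Suc c)\<^sup>2"
  have "\<P>(x in gauss_seq. \<forall>n\<ge>l. 0 \<le> (\<Sum>j<n. x j))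
    \<le> \<P>(x in gauss_seq. \<forall>n\<in>{l..u}. 0 \<le> (\<Sum>j<n. x j)) * \<P>(y in gauss_seq. - sqrt (real ?r) \<le> (\<Sum>j<?r. y j))
      + \<P>(x in gauss_seq. real c < (\<Sum>j<u. x j))"
  proof (rule std_normal_sequence.prob_comb_seq_le)
    fix x y :: "nat \<Rightarrow> real"
    assume nonneg: "\<forall>n\<ge>l. 0 \<le> (\<Sum>j<n. comb_seq u x y j)"
    have "0 \<le> (\<Sum>j<u. x j) + (\<Sum>j<?r. y j)"
      using nonneg assms by (simp flip: sum_comb_seq)
    then have "real c < (\<Sum>j<u. x j) \<or> - sqrt (real ?r) \<le> (\<Sum>j<?r. y j)"
      by auto
    moreover have "0 \<le> (\<Sum>j<n. x j)" if "n \<in> {l..u}" for n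
    proof -
      have "(\<Sum>j<n. comb_seq u x y j) = (\<Sum>j<n. x j)"
        using that by (intro sum.cong) (auto simp: comb_seq_less)
      with nonneg that show ?thesis
        by (metis atLeastAtMost_iff)
    qed
    ultimately show "(\<forall>n\<in>{l..u}. 0 \<le> (\<Sum>j<n. x j)) \<and> - sqrt (real ?r) \<le> (\<Sum>j<?r. y j)
        \<or> real c < (\<Sum>j<u. x j)"
      by blast
  qed measurable
  then show ?thesis
    by (simp only: prob_gauss_seq_sum_ge zero_less_power zero_less_Suc)
qed

lemma AE_gauss_seq_sum_neg: "AE x in gauss_seq. \<exists>n\<ge>l. (\<Sum>j<n. x j) < 0"
proof -
  let ?S = "\<lambda>n x. \<Sum>j<n. x j :: real" and ?p = "measure std_normal {..<-1}"
  let ?E = "{x \<in> space gauss_seq. \<forall>n\<ge>l. 0 \<le> ?S n x}"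
  let ?A = "\<lambda>u. {x \<in> space gauss_seq. \<forall>n\<in>{l..u}. 0 \<le> ?S n x}"
  let ?C = "\<lambda>u c. {x \<in> space gauss_seq. real c < ?S u x}"
  have "gauss_seq.prob ?E \<le> gauss_seq.prob (?A u) * (1 - ?p)" if "l \<le> u" for u
  proof -
    have "(\<lambda>c. gauss_seq.prob (?C u c)) \<longlonglongrightarrow> gauss_seq.prob (\<Inter>c. ?C u c)"
      by (intro gauss_seq.finite_Lim_measure_decseq) (auto simp: decseq_def intro: le_less_trans)
    also have "(\<Inter>c. ?C u c) = {}"
      using reals_Archimedean2 by (auto intro: less_asym)
    finally have "(\<lambda>c. gauss_seq.prob (?A u) * (1 - ?p) + gauss_seq.prob (?C u c))
        \<longlonglongrightarrow> gauss_seq.prob (?A u) * (1 - ?p) + 0"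
      by (intro tendsto_intros) simp
    then show ?thesis
      using prob_gauss_seq_sums_nonneg_le[OF that] by (intro LIMSEQ_le_const) auto
  qed
  moreover have "(\<lambda>u. gauss_seq.prob (?A u) * (1 - ?p)) \<longlonglongrightarrow> gauss_seq.prob (\<Inter>u. ?A u) * (1 - ?p)"
    by (intro tendsto_intros gauss_seq.finite_Lim_measure_decseq) (auto simp: decseq_def)
  moreover have "(\<Inter>u. ?A u) = ?E"
    by (auto; metis atLeastAtMost_iff order_refl)
  ultimately have "gauss_seq.prob ?E \<le> gauss_seq.prob ?E * (1 - ?p)"
    by (intro LIMSEQ_le_const[where X = "\<lambda>u. gauss_seq.prob (?A u) * (1 - ?p)"]) auto
  then have "gauss_seq.prob ?E * ?p \<le> 0"
    by (simp add: algebra_simps)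
  then have "gauss_seq.prob ?E = 0"
    using measure_std_normal_less_neg_one_pos by (simp add: mult_le_0_iff measure_le_0_iff)
  then show ?thesis
    by (subst AE_iff_measurable[where N = ?E]) (auto simp: gauss_seq.emeasure_eq_measure not_less)
qed

lemma AE_gauss_seq_mean_eventually_gt:
  assumes "0 < a"
  shows "AE x in gauss_seq. \<forall>\<^sub>F n in sequentially. - a < running_mean x n"
proof -
  let ?A = "\<lambda>u. {x \<in> space gauss_seq. \<exists>n\<ge>Suc u. running_mean x n \<le> - a}"
  let ?E = "{x \<in> space gauss_seq. \<forall>u. \<exists>n\<ge>Suc u. running_mean x n \<le> - a}"
  have "(\<lambda>u. gauss_tail a ^ Suc u) \<longlonglongrightarrow> 0"
    using assms by (intro LIMSEQ_Suc LIMSEQ_realpow_zero) (auto simp: less_imp_le)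
  moreover have "gauss_seq.prob ?E \<le> gauss_tail a ^ Suc u" for u
  proof -
    have "gauss_seq.prob ?E \<le> gauss_seq.prob (?A u)"
      by (intro gauss_seq.finite_measure_mono) auto
    also have "\<dots> \<le> gauss_tail a ^ Suc u"
      using assms by (intro prob_gauss_seq_mean_le) auto
    finally show ?thesis .
  qed
  ultimately have "gauss_seq.prob ?E \<le> 0"
    using LIMSEQ_le_const by blast
  then have "gauss_seq.prob ?E = 0"
    by (simp add: measure_le_0_iff)
  moreover have "(\<forall>\<^sub>F n in sequentially. - a < running_mean x n)
      \<longleftrightarrow> \<not> (\<forall>u. \<exists>n\<ge>Suc u. running_mean x n \<le> - a)" for x
    by (meson Suc_leD eventually_sequentially not_le not_less_eq_eq order_trans)
  ultimately show ?thesis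
    by (subst AE_iff_measurable[where N = ?E]) (auto simp: gauss_seq.emeasure_eq_measure)
qed

definition late_minimum :: "nat \<Rightarrow> nat \<Rightarrow> (nat \<Rightarrow> real) \<Rightarrow> bool" where
  "late_minimum l u x \<longleftrightarrow> (\<exists>n\<ge>l. \<forall>p\<in>{l..u}. running_mean x n < running_mean x p)"

lemma measurable_late_minimum [measurable]: "Measurable.pred gauss_seq (late_minimum l u)"
  unfolding late_minimum_def[abs_def] by measurable

lemma AE_gauss_seq_not_late_minimum:
  assumes "1 \<le> l"
  shows "AE x in gauss_seq. \<exists>u. \<not> late_minimum l u x"
proof -
  have "AE x in gauss_seq. \<forall>i::nat. \<forall>\<^sub>F n in sequentially. - inverse (real (Suc i)) < running_mean x n"
    unfolding AE_all_countable by (intro allI AE_gauss_seq_mean_eventually_gt) simp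
  with AE_gauss_seq_sum_neg[of l] show ?thesis
  proof eventually_elim
    case (elim x)
    then obtain p where negative: "l \<le> p" "running_mean x p < 0"
      using assms by (force simp: running_mean_def divide_neg_pos)
    then obtain i where "inverse (real (Suc i)) < - running_mean x p"
      using reals_Archimedean[of "- running_mean x p"] by auto
    moreover obtain u where "\<forall>n\<ge>u. - inverse (real (Suc i)) < running_mean x n"
      using elim(2) by (auto simp: eventually_sequentially)
    ultimately have tail: "running_mean x p < running_mean x n" if "u \<le> n" for n
      using that by fastforce
    have "\<not> late_minimum l (max p u) x"
    proof
      assume "late_minimum l (max p u) x"
      then obtain n where below: "l \<le> n" "\<And>q. q \<in> {l..max p u} \<Longrightarrow> running_mean x n < running_mean x q"
        unfolding late_minimum_def by blast
      then have "u \<le> n"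
        by (metis atLeastAtMost_iff less_irrefl max.coboundedI2 nat_le_linear)
      with tail below(2)[of p] negative(1) show False
        by force
    qed
    then show ?case ..
  qed
qed

lemma prob_gauss_seq_late_minimum_tendsto_0:
  assumes "1 \<le> l"
  shows "(\<lambda>u. \<P>(x in gauss_seq. late_minimum l u x)) \<longlonglongrightarrow> 0"
proof -
  let ?A = "\<lambda>u. {x \<in> space gauss_seq. late_minimum l u x}"
  have "(\<lambda>u. gauss_seq.prob (?A u)) \<longlonglongrightarrow> gauss_seq.prob (\<Inter>u. ?A u)"
    by (intro gauss_seq.finite_Lim_measure_decseq) (auto simp: decseq_def late_minimum_def)
  also have "gauss_seq.prob (\<Inter>u. ?A u) = 0"
    using AE_gauss_seq_not_late_minimum[OF assms]
    by (subst gauss_seq.prob_eq_0) (auto elim!: eventually_mono)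
  finally show ?thesis .
qed

lemma exists_mult_prob_late_minimum_less:
  assumes "1 \<le> l" "0 < \<epsilon>"
  shows "\<exists>u\<ge>l. c * \<P>(x in gauss_seq. late_minimum l u x) < \<epsilon>"
proof -
  have "(\<lambda>u. c * \<P>(x in gauss_seq. late_minimum l u x)) \<longlonglongrightarrow> c * 0"
    by (intro tendsto_intros prob_gauss_seq_late_minimum_tendsto_0) fact
  then have "\<forall>\<^sub>F u in sequentially. c * \<P>(x in gauss_seq. late_minimum l u x) < \<epsilon>"
    using assms(2) by (intro order_tendstoD) auto
  then show ?thesis
    by (metis (mono_tags, lifting) eventually_sequentially nat_le_linear)
qed

section \<open>Sums of independent square-integrable variables\<close>

lemma integrable_power2_add:
  fixes X Y :: "'a \<Rightarrow> real"
  assumes [measurable]: "X \<in> borel_measurable M" "Y \<in> borel_measurable M"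
    and "integrable M (\<lambda>\<omega>. (X \<omega>)\<^sup>2)" "integrable M (\<lambda>\<omega>. (Y \<omega>)\<^sup>2)"
  shows "integrable M (\<lambda>\<omega>. (X \<omega> + Y \<omega>)\<^sup>2)"
proof (rule Bochner_Integration.integrable_bound)
  show "integrable M (\<lambda>\<omega>. 2 * (X \<omega>)\<^sup>2 + 2 * (Y \<omega>)\<^sup>2)"
    using assms by simp
  have "(X \<omega> + Y \<omega>)\<^sup>2 \<le> 2 * (X \<omega>)\<^sup>2 + 2 * (Y \<omega>)\<^sup>2" for \<omega>
    using sum_squares_bound[of "X \<omega>" "Y \<omega>"] by (simp add: power2_sum)
  then show "AE \<omega> in M. norm ((X \<omega> + Y \<omega>)\<^sup>2) \<le> norm (2 * (X \<omega>)\<^sup>2 + 2 * (Y \<omega>)\<^sup>2)"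
    by simp
qed measurable

lemma integrable_power2_sum:
  fixes X :: "'i \<Rightarrow> 'a \<Rightarrow> real"
  assumes "\<And>i. i \<in> I \<Longrightarrow> X i \<in> borel_measurable M" "\<And>i. i \<in> I \<Longrightarrow> integrable M (\<lambda>\<omega>. (X i \<omega>)\<^sup>2)"
  shows "integrable M (\<lambda>\<omega>. (\<Sum>i\<in>I. X i \<omega>)\<^sup>2)"
  using assms
  by (induction I rule: infinite_finite_induct) (auto intro!: integrable_power2_add borel_measurable_sum)

lemma (in prob_space) variance_add_indep:
  fixes X Y :: "'a \<Rightarrow> real"
  assumes indep: "indep_var borel X borel Y"
    and square: "integrable M (\<lambda>\<omega>. (X \<omega>)\<^sup>2)" "integrable M (\<lambda>\<omega>. (Y \<omega>)\<^sup>2)"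
  shows "variance (\<lambda>\<omega>. X \<omega> + Y \<omega>) = variance X + variance Y"
proof -
  have [measurable]: "random_variable borel X" "random_variable borel Y"
    using indep_var_rv1[OF indep] indep_var_rv2[OF indep] .
  have integrable: "integrable M X" "integrable M Y"
    using square by (simp_all add: square_integrable_imp_integrable)
  note product = indep_var_integrable[OF indep integrable] indep_var_lebesgue_integral[OF indep integrable]
  have "expectation (\<lambda>\<omega>. (X \<omega> + Y \<omega>)\<^sup>2) = expectation (\<lambda>\<omega>. (X \<omega>)\<^sup>2 + (Y \<omega>)\<^sup>2 + 2 * (X \<omega> * Y \<omega>))"
    by (simp only: power2_sum mult.assoc)
  also have "\<dots> = expectation (\<lambda>\<omega>. (X \<omega>)\<^sup>2) + expectation (\<lambda>\<omega>. (Y \<omega>)\<^sup>2) + 2 * (expectation X * expectation Y)"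
    using square product by simp
  finally show ?thesis
    using variance_eq[OF integrable(1) square(1)] variance_eq[OF integrable(2) square(2)]
      variance_eq[OF Bochner_Integration.integrable_add[OF integrable] integrable_power2_add[OF _ _ square]]
      integrable
    by (simp add: power2_sum)
qed

lemma (in prob_space) variance_sum_indep:
  fixes X :: "'i \<Rightarrow> 'a \<Rightarrow> real"
  assumes "finite I" "indep_vars (\<lambda>_. borel) X I" "\<And>i. i \<in> I \<Longrightarrow> integrable M (\<lambda>\<omega>. (X i \<omega>)\<^sup>2)"
  shows "variance (\<lambda>\<omega>. \<Sum>i\<in>I. X i \<omega>) = (\<Sum>i\<in>I. variance (X i))"
  using assms
proof (induction I rule: finite_induct)
  case (insert i I)
  have "random_variable borel (X j)" if "j \<in> I" for j
    using insert.prems(1) that by (auto simp: indep_vars_def)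
  then have "integrable M (\<lambda>\<omega>. (\<Sum>i\<in>I. X i \<omega>)\<^sup>2)"
    using insert.prems(2) by (intro integrable_power2_sum) auto
  then have "variance (\<lambda>\<omega>. X i \<omega> + (\<Sum>i\<in>I. X i \<omega>)) = variance (X i) + variance (\<lambda>\<omega>. \<Sum>i\<in>I. X i \<omega>)"
    using insert by (intro variance_add_indep indep_vars_sum) auto
  moreover have "variance (\<lambda>\<omega>. \<Sum>i\<in>I. X i \<omega>) = (\<Sum>i\<in>I. variance (X i))"
    using insert.prems(2) by (intro insert.IH indep_vars_subset[OF insert.prems(1)]) auto
  ultimately show ?case
    using insert.hyps by simp
qed simp

lemma (in prob_space) prob_sum_indep_ge_le:
  fixes X :: "'i \<Rightarrow> 'a \<Rightarrow> real"
  assumes "finite I" "I \<noteq> {}" and indep: "indep_vars (\<lambda>_. borel) X I"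
    and square: "\<And>i. i \<in> I \<Longrightarrow> integrable M (\<lambda>\<omega>. (X i \<omega>)\<^sup>2)"
    and mean_le: "\<And>i. i \<in> I \<Longrightarrow> expectation (X i) \<le> e"
    and variance_le: "\<And>i. i \<in> I \<Longrightarrow> variance (X i) \<le> v" and "0 < \<gamma>"
  shows "\<P>(\<omega> in M. (e + \<gamma>) * real (card I) \<le> (\<Sum>i\<in>I. X i \<omega>)) \<le> v / (\<gamma>\<^sup>2 * real (card I))"
proof -
  let ?Y = "\<lambda>\<omega>. \<Sum>i\<in>I. X i \<omega>" and ?k = "real (card I)"
  have card_pos: "0 < ?k"
    using assms by (simp add: card_gt_0_iff)
  have measurable_X: "random_variable borel (X i)" if "i \<in> I" for i
    using indep that by (auto simp: indep_vars_def)
  have [measurable]: "random_variable borel ?Y"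
    by (rule borel_measurable_sum) (rule measurable_X)
  have "expectation ?Y = (\<Sum>i\<in>I. expectation (X i))"
    by (intro Bochner_Integration.integral_sum) (rule square_integrable_imp_integrable[OF measurable_X square])
  also have "\<dots> \<le> e * ?k"
    using sum_mono[OF mean_le] by (simp add: mult.commute)
  finally have "\<P>(\<omega> in M. (e + \<gamma>) * ?k \<le> ?Y \<omega>) \<le> \<P>(\<omega> in M. \<gamma> * ?k \<le> \<bar>?Y \<omega> - expectation ?Y\<bar>)"
    by (intro finite_measure_mono) (auto simp: algebra_simps)
  also have "\<dots> \<le> variance ?Y / (\<gamma> * ?k)\<^sup>2"
    using integrable_power2_sum[OF measurable_X square] \<open>0 < \<gamma>\<close> card_pos
    by (intro Chebyshev_inequality) auto
  also have "\<dots> \<le> v * ?k / (\<gamma> * ?k)\<^sup>2"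
    using variance_sum_indep[OF \<open>finite I\<close> indep square] sum_mono[OF variance_le]
    by (intro divide_right_mono) (auto simp: mult.commute)
  also have "\<dots> = v / (\<gamma>\<^sup>2 * ?k)"
    using card_pos by (simp add: power2_eq_square)
  finally show ?thesis .
qed

section \<open>Number of events that occur\<close>

lemma (in prob_space)
  fixes c :: "'i \<Rightarrow> real"
  assumes "finite A" and [measurable]: "\<And>n. n \<in> A \<Longrightarrow> Measurable.pred M (P n)"
  shows integrable_sum_events: "integrable M (\<lambda>\<omega>. \<Sum>n | n \<in> A \<and> P n \<omega>. c n)"
    and expectation_sum_events:
      "expectation (\<lambda>\<omega>. \<Sum>n | n \<in> A \<and> P n \<omega>. c n) = (\<Sum>n\<in>A. c n * \<P>(\<omega> in M. P n \<omega>))"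
proof -
  let ?E = "\<lambda>n. {\<omega> \<in> space M. P n \<omega>}"
  have indicators: "(\<Sum>n | n \<in> A \<and> P n \<omega>. c n) = (\<Sum>n\<in>A. c n * indicator (?E n) \<omega>)" if "\<omega> \<in> space M" for \<omega>
    using assms(1) that by (intro sum.mono_neutral_cong_left) (auto simp: indicator_def)
  show "integrable M (\<lambda>\<omega>. \<Sum>n | n \<in> A \<and> P n \<omega>. c n)"
    by (subst Bochner_Integration.integrable_cong[OF refl indicators])
      (auto intro!: Bochner_Integration.integrable_sum simp: emeasure_eq_measure)
  show "expectation (\<lambda>\<omega>. \<Sum>n | n \<in> A \<and> P n \<omega>. c n) = (\<Sum>n\<in>A. c n * prob (?E n))"
    by (subst Bochner_Integration.integral_cong[OF refl indicators])
      (auto simp: Bochner_Integration.integral_sum emeasure_eq_measure)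
qed

lemma (in prob_space) expectation_card_events_geometric_le:
  assumes [measurable]: "\<And>n. Measurable.pred M (P n)"
    and prob_le: "\<And>n. l \<le> n \<Longrightarrow> \<P>(\<omega> in M. P n \<omega>) \<le> q ^ n" and "0 < q" "q < 1"
  shows "expectation (\<lambda>\<omega>. real (card {n \<in> {l..<u}. P n \<omega>})) \<le> q ^ l / (1 - q)"
proof -
  have "expectation (\<lambda>\<omega>. real (card {n \<in> {l..<u}. P n \<omega>})) = (\<Sum>n\<in>{l..<u}. \<P>(\<omega> in M. P n \<omega>))"
    using expectation_sum_events[of "{l..<u}" P, where c = "\<lambda>_. 1"] by simp
  also have "\<dots> \<le> (\<Sum>n\<in>{l..<u}. q ^ n)"
    by (intro sum_mono prob_le) simp
  also have "\<dots> = q ^ l * (\<Sum>n<u - l. q ^ n)"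
    by (simp add: sum.atLeastLessThan_shift_0[of _ l] power_add sum_distrib_left lessThan_atLeast0)
  also have "\<dots> \<le> q ^ l * (\<Sum>n. q ^ n)"
    using \<open>0 < q\<close> \<open>q < 1\<close> by (intro mult_left_mono sum_le_suminf) auto
  also have "\<dots> = q ^ l / (1 - q)"
    using \<open>0 < q\<close> \<open>q < 1\<close> by (simp add: suminf_geometric)
  finally show ?thesis .
qed

lemma card_power2_le_sum_odd: "finite C \<Longrightarrow> (card C)\<^sup>2 \<le> (\<Sum>n\<in>C. 2 * n + 1)" for C :: "nat set"
proof (induction C rule: finite_linorder_max_induct)
  case (insert b C)
  then have "card C \<le> b"
    using card_mono[of "{..<b}" C] by auto
  with insert show ?case
    by (subst sum.insert card_insert_disjoint; force simp: power2_eq_square)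
qed simp

lemma (in prob_space) integrable_card_events_power2:
  assumes "finite A" and "\<And>n. n \<in> A \<Longrightarrow> Measurable.pred M (P n)"
  shows "integrable M (\<lambda>\<omega>. (real (card {n \<in> A. P n \<omega>}))\<^sup>2)"
proof (rule integrable_const_bound)
  show "AE \<omega> in M. norm ((real (card {n \<in> A. P n \<omega>}))\<^sup>2) \<le> (real (card A))\<^sup>2"
    using \<open>finite A\<close> by (auto intro!: power_mono card_mono)
  have "random_variable borel (\<lambda>\<omega>. real (card {n \<in> A. P n \<omega>}))"
    using integrable_sum_events[OF assms, where c = "\<lambda>_. 1"] by simp
  then show "random_variable borel (\<lambda>\<omega>. (real (card {n \<in> A. P n \<omega>}))\<^sup>2)"
    by measurable
qed

lemma (in prob_space) variance_card_events_geometric_le: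
  fixes P :: "nat \<Rightarrow> 'a \<Rightarrow> bool"
  assumes pred: "\<And>n. Measurable.pred M (P n)"
    and prob_le: "\<And>n. l \<le> n \<Longrightarrow> \<P>(\<omega> in M. P n \<omega>) \<le> q ^ n" and "0 < q" "q < 1"
  shows "variance (\<lambda>\<omega>. real (card {n \<in> {l..<u}. P n \<omega>})) \<le> 2 / (1 - q)\<^sup>2"
proof -
  let ?X = "\<lambda>\<omega>. real (card {n \<in> {l..<u}. P n \<omega>})"
  have sums: "(\<lambda>n. real (Suc n) * q ^ n) sums (1 / (1 - q)\<^sup>2)"
    using \<open>0 < q\<close> \<open>q < 1\<close> by (intro geometric_deriv_sums) auto
  have square: "integrable M (\<lambda>\<omega>. (?X \<omega>)\<^sup>2)"
    using pred by (intro integrable_card_events_power2) auto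
  then have "variance ?X \<le> expectation (\<lambda>\<omega>. (?X \<omega>)\<^sup>2)"
    using integrable_sum_events[of "{l..<u}" P, where c = "\<lambda>_. 1"] pred by (subst variance_eq) auto
  also have "\<dots> \<le> expectation (\<lambda>\<omega>. \<Sum>n | n \<in> {l..<u} \<and> P n \<omega>. real (2 * n + 1))"
  proof (rule integral_mono[OF square integrable_sum_events])
    fix \<omega>
    show "(?X \<omega>)\<^sup>2 \<le> (\<Sum>n | n \<in> {l..<u} \<and> P n \<omega>. real (2 * n + 1))"
      using card_power2_le_sum_odd[of "{n \<in> {l..<u}. P n \<omega>}"]
      by (simp only: of_nat_sum[symmetric] of_nat_power[symmetric] of_nat_le_iff) simp
  qed (use pred in auto)
  also have "\<dots> = (\<Sum>n\<in>{l..<u}. real (2 * n + 1) * \<P>(\<omega> in M. P n \<omega>))"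
    using pred by (intro expectation_sum_events) auto
  also have "\<dots> \<le> (\<Sum>n\<in>{l..<u}. 2 * (real (Suc n) * q ^ n))"
    using \<open>0 < q\<close> unfolding mult.assoc[symmetric] by (intro sum_mono mult_mono prob_le) auto
  also have "\<dots> \<le> (\<Sum>n. 2 * (real (Suc n) * q ^ n))"
    using sums_summable[OF sums] \<open>0 < q\<close> by (intro sum_le_suminf summable_mult) auto
  also have "\<dots> = 2 / (1 - q)\<^sup>2"
    using sums_unique[OF sums_mult[OF sums, of 2]] by simp
  finally show ?thesis .
qed

lemma prob_gauss_seq_exceed_le:
  assumes "0 < a" "1 \<le> n"
  shows "\<P>(x in gauss_seq. a \<le> running_mean x n) \<le> gauss_tail a ^ n"
proof -
  have "\<P>(x in gauss_seq. a \<le> running_mean x n) \<le> \<P>(x in gauss_seq. \<exists>p\<ge>n. a \<le> running_mean x p)"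
    by (intro gauss_seq.finite_measure_mono) auto
  also have "\<dots> \<le> gauss_tail a ^ n"
    by (rule prob_gauss_seq_mean_ge) fact+
  finally show ?thesis .
qed

lemma
  assumes "0 < a" "1 \<le> l"
  shows expectation_exceed_count_le:
      "gauss_seq.expectation (exceed_count a {l..<u}) \<le> gauss_tail a ^ l / (1 - gauss_tail a)"
    and variance_exceed_count_le:
      "gauss_seq.variance (exceed_count a {l..<u}) \<le> 2 / (1 - gauss_tail a)\<^sup>2"
  unfolding exceed_count_def using assms
  by (intro gauss_seq.expectation_card_events_geometric_le gauss_seq.variance_card_events_geometric_le
      prob_gauss_seq_exceed_le; simp)+

lemma measurable_exceed_count [measurable]:
  "(\<lambda>x. real (exceed_count a A x)) \<in> borel_measurable gauss_seq"
  unfolding exceed_count_def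
  by (rule measurable_compose[OF measurable_card borel_measurable_count_space]) measurable

section \<open>Arrays of standard normal variables\<close>

definition gauss_array :: "(nat \<times> nat \<Rightarrow> real) measure" where
  "gauss_array = PiM UNIV (\<lambda>_. std_normal)"

interpretation gauss_array: prob_space gauss_array
  unfolding gauss_array_def by (intro prob_space_PiM std_normal.prob_space_axioms)

lemma measurable_gauss_array [measurable]: "(\<lambda>z. z p) \<in> borel_measurable gauss_array"
  using measurable_component_singleton[of p UNIV "\<lambda>_. std_normal"] by (simp add: gauss_array_def)

lemma indep_vars_gauss_array: "gauss_array.indep_vars (\<lambda>_. std_normal) (\<lambda>p z. z p) UNIV"
  unfolding gauss_array_def by (intro indep_vars_PiM_components std_normal.prob_space_axioms) simp

lemma measurable_curry_gauss_array [measurable]: "(\<lambda>z. curry z i) \<in> measurable gauss_array gauss_seq"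
proof -
  have "(\<lambda>z. \<lambda>j\<in>UNIV. z (i, j)) \<in> measurable gauss_array gauss_seq"
    unfolding gauss_seq_def by (rule measurable_restrict) simp
  then show ?thesis
    by (simp add: curry_def restrict_UNIV)
qed

lemma distr_curry_gauss_array: "distr gauss_array gauss_seq (\<lambda>z. curry z i) = gauss_seq"
  using distr_PiM_reindex[of UNIV "\<lambda>_. std_normal" "Pair i" UNIV]
  by (simp add: gauss_array_def gauss_seq_def curry_def restrict_UNIV inj_on_def std_normal.prob_space_axioms)

lemma indep_vars_curry_gauss_array: "gauss_array.indep_vars (\<lambda>_. gauss_seq) (\<lambda>i z. curry z i) UNIV"
proof -
  have "gauss_array.indep_vars (\<lambda>i. PiM ({i} \<times> UNIV) (\<lambda>_. std_normal))
      (\<lambda>i z. restrict (\<lambda>p. z p) ({i} \<times> UNIV)) UNIV"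
    by (rule gauss_array.indep_vars_restrict[OF indep_vars_gauss_array]) (auto simp: disjoint_family_on_def)
  moreover have "(\<lambda>f. \<lambda>j\<in>UNIV. f (i, j)) \<in> measurable (PiM ({i} \<times> UNIV) (\<lambda>_. std_normal)) gauss_seq" for i :: nat
    unfolding gauss_seq_def by (intro measurable_restrict measurable_component_singleton) auto
  ultimately have "gauss_array.indep_vars (\<lambda>_. gauss_seq)
      (\<lambda>i z. (\<lambda>f. \<lambda>j\<in>UNIV. f (i, j)) (restrict (\<lambda>p. z p) ({i} \<times> UNIV))) UNIV"
    by (rule gauss_array.indep_vars_compose2)
  then show ?thesis
    by (simp add: curry_def restrict_UNIV)
qed

lemma prob_curry_gauss_array:
  assumes "Measurable.pred gauss_seq P"
  shows "\<P>(z in gauss_array. P (curry z i)) = \<P>(x in gauss_seq. P x)"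
proof -
  have "\<P>(x in gauss_seq. P x)
      = measure (distr gauss_array gauss_seq (\<lambda>z. curry z i)) {x \<in> space gauss_seq. P x}"
    by (simp only: distr_curry_gauss_array)
  also have "\<dots> = gauss_array.prob ((\<lambda>z. curry z i) -` {x \<in> space gauss_seq. P x} \<inter> space gauss_array)"
    using assms by (intro measure_distr) auto
  also have "(\<lambda>z. curry z i) -` {x \<in> space gauss_seq. P x} \<inter> space gauss_array
      = {z \<in> space gauss_array. P (curry z i)}"
    using measurable_space[OF measurable_curry_gauss_array] by blast
  finally show ?thesis ..
qed

lemma integral_curry_gauss_array:
  fixes f :: "(nat \<Rightarrow> real) \<Rightarrow> real"
  assumes "f \<in> borel_measurable gauss_seq"
  shows "gauss_array.expectation (\<lambda>z. f (curry z i)) = gauss_seq.expectation f"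
  using integral_distr[OF measurable_curry_gauss_array assms, of i] by (simp add: distr_curry_gauss_array)

lemma prob_sum_exceed_count_ge_le:
  assumes "0 < a" "1 \<le> l" "0 < \<gamma>" "0 < k"
  shows "\<P>(z in gauss_array. (gauss_tail a ^ l / (1 - gauss_tail a) + \<gamma>) * real k
      \<le> (\<Sum>i<k. real (exceed_count a {l..<u} (curry z i))))
    \<le> 2 / (1 - gauss_tail a)\<^sup>2 / (\<gamma>\<^sup>2 * real k)"
proof -
  let ?X = "\<lambda>i z. real (exceed_count a {l..<u} (curry z i))"
  have "gauss_array.indep_vars (\<lambda>_. gauss_seq) (\<lambda>i z. curry z i) {..<k}"
    by (rule gauss_array.indep_vars_subset[OF indep_vars_curry_gauss_array]) simp
  then have "gauss_array.indep_vars (\<lambda>_. borel) ?X {..<k}"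
    by (rule gauss_array.indep_vars_compose2) simp
  moreover have "integrable gauss_array (\<lambda>z. (?X i z)\<^sup>2)" for i
    unfolding exceed_count_def by (rule gauss_array.integrable_card_events_power2) auto
  moreover have "gauss_array.expectation (?X i) \<le> gauss_tail a ^ l / (1 - gauss_tail a)" for i
    using expectation_exceed_count_le[OF assms(1,2)] by (subst integral_curry_gauss_array) simp_all
  moreover have "gauss_array.variance (?X i) \<le> 2 / (1 - gauss_tail a)\<^sup>2" for i
    using variance_exceed_count_le[OF assms(1,2)] by (subst (1 2) integral_curry_gauss_array) simp_all
  ultimately have "\<P>(z in gauss_array. (gauss_tail a ^ l / (1 - gauss_tail a) + \<gamma>) * real (card {..<k})
      \<le> (\<Sum>i<k. ?X i z)) \<le> 2 / (1 - gauss_tail a)\<^sup>2 / (\<gamma>\<^sup>2 * real (card {..<k}))"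
    using assms by (intro gauss_array.prob_sum_indep_ge_le) (auto simp: lessThan_empty_iff)
  then show ?thesis
    by simp
qed

definition normal_array ::
    "(nat \<Rightarrow> real) \<Rightarrow> (nat \<Rightarrow> real) \<Rightarrow> nat \<Rightarrow> nat \<Rightarrow> (nat \<times> nat \<Rightarrow> real) \<Rightarrow> nat \<times> nat \<Rightarrow> real" where
  "normal_array \<mu> \<sigma> k N z = (\<lambda>p\<in>{..<k} \<times> {..<N}. \<mu> (fst p) + \<sigma> (fst p) * z p)"

lemma running_mean_normal_array:
  assumes "i < k" "1 \<le> n" "n \<le> N"
  shows "running_mean (curry (normal_array \<mu> \<sigma> k N z) i) n = \<mu> i + \<sigma> i * running_mean (curry z i) n"
proof -
  have "(\<Sum>j<n. curry (normal_array \<mu> \<sigma> k N z) i j) = (\<Sum>j<n. \<mu> i + \<sigma> i * z (i, j))"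
    using assms by (intro sum.cong) (auto simp: normal_array_def)
  also have "\<dots> = real n * \<mu> i + \<sigma> i * (\<Sum>j<n. z (i, j))"
    by (simp add: sum.distrib sum_distrib_left)
  finally show ?thesis
    using assms by (simp add: running_mean_def field_simps)
qed

lemma measurable_normal_array [measurable]:
  "normal_array \<mu> \<sigma> k N \<in> measurable gauss_array (obs_space \<mu> \<sigma> k N)"
  unfolding normal_array_def[abs_def] obs_space_def by (rule measurable_restrict) auto

lemma distr_normal_array:
  assumes "\<And>i. i < k \<Longrightarrow> 0 < \<sigma> i" "0 < k" "0 < N"
  shows "distr gauss_array (obs_space \<mu> \<sigma> k N) (normal_array \<mu> \<sigma> k N) = obs_space \<mu> \<sigma> k N"
proof -
  let ?I = "{..<k} \<times> {..<N}"
  let ?D = "\<lambda>(i, j). density lborel (\<lambda>x. ennreal (normal_density (\<mu> i) (\<sigma> i) x))"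
  have "gauss_array.indep_vars (\<lambda>_. std_normal) (\<lambda>p z. z p) ?I"
    by (rule gauss_array.indep_vars_subset[OF indep_vars_gauss_array]) simp
  then have "gauss_array.indep_vars ?D (\<lambda>p z. (\<lambda>y. \<mu> (fst p) + \<sigma> (fst p) * y) (z p)) ?I"
    by (rule gauss_array.indep_vars_compose2) auto
  then have "distr gauss_array (PiM ?I ?D) (\<lambda>z. \<lambda>p\<in>?I. \<mu> (fst p) + \<sigma> (fst p) * z p)
      = PiM ?I (\<lambda>p. distr gauss_array (?D p) (\<lambda>z. \<mu> (fst p) + \<sigma> (fst p) * z p))"
    using assms by (subst (asm) gauss_array.indep_vars_iff_distr_eq_PiM') auto
  also have "\<dots> = PiM ?I ?D"
  proof (rule PiM_cong[OF refl])
    fix p assume in_index: "p \<in> ?I"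
    have "distributed gauss_array lborel (\<lambda>z. z p) std_normal_density"
      unfolding gauss_array_def
      by (rule distributed_PiM_component) (simp_all add: std_normal.prob_space_axioms)
    moreover have "0 < \<sigma> (fst p)"
      using assms(1) in_index by auto
    ultimately have "distributed gauss_array lborel (\<lambda>z. \<mu> (fst p) + \<sigma> (fst p) * z p)
        (normal_density (\<mu> (fst p)) (\<sigma> (fst p)))"
      using gauss_array.normal_density_affine[of "\<lambda>z. z p" 0 1 "\<sigma> (fst p)" "\<mu> (fst p)"] by simp
    then have "distr gauss_array lborel (\<lambda>z. \<mu> (fst p) + \<sigma> (fst p) * z p) = ?D p"
      by (simp add: distributed_def split_beta)
    then show "distr gauss_array (?D p) (\<lambda>z. \<mu> (fst p) + \<sigma> (fst p) * z p) = ?D p"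
      by (metis (no_types, lifting) distr_cong sets_density split_beta)
  qed
  finally show ?thesis
    by (simp add: obs_space_def normal_array_def[abs_def])
qed

section \<open>Measurability of the selected set\<close>

lemma borel_measurable_PiM_component:
  assumes "\<And>i. i \<in> I \<Longrightarrow> sets (M i) = sets borel"
  shows "(\<lambda>x. x i) \<in> borel_measurable (PiM I M)"
proof (cases "i \<in> I")
  case True
  then show ?thesis
    using measurable_component_singleton[OF True, of M] by (simp cong: measurable_cong_sets add: assms)
next
  case False
  then have "x i = undefined" if "x \<in> space (PiM I M)" for x
    using that by (auto simp: space_PiM PiE_def extensional_def)
  then show ?thesis
    by (subst measurable_cong[where g = "\<lambda>_. undefined"]) auto
qed

lemma measurable_obs_space_component [measurable]:
  "(\<lambda>X. X p) \<in> borel_measurable (obs_space \<mu> \<sigma> k N)"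
  unfolding obs_space_def by (rule borel_measurable_PiM_component) auto

lemma pred_top_set:
  assumes [measurable]: "\<And>j. (\<lambda>X. f X j) \<in> borel_measurable M"
  shows "Measurable.pred M (\<lambda>X. i \<in> top_set m k (f X))"
  unfolding top_set_def mem_Collect_eq by measurable

lemma pred_efg_set_if_counts:
  assumes [measurable]: "\<And>p. (\<lambda>X. X p) \<in> borel_measurable M"
    and counts: "\<And>i. (\<lambda>X. efg_counts m k n0 X t i) \<in> measurable M (count_space UNIV)"
  shows "Measurable.pred M (\<lambda>X. i \<in> efg_set m k n0 X t)"
  unfolding efg_set_def efg_mean_def
proof (rule pred_top_set)
  fix j
  show "(\<lambda>X. running_mean (curry X j) (efg_counts m k n0 X t j)) \<in> borel_measurable M"
    by (rule measurable_compose_countable[OF _ counts]) (simp add: curry_def measurable_running_mean)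
qed

lemma measurable_efg_counts:
  assumes "\<And>p. (\<lambda>X. X p) \<in> borel_measurable M"
  shows "(\<lambda>X. efg_counts m k n0 X t i) \<in> measurable M (count_space UNIV)"
proof (induction t arbitrary: i)
  case (Suc t)
  note [measurable] = Suc pred_efg_set_if_counts[OF assms Suc]
  show ?case
    unfolding efg_counts_Suc by measurable
qed simp

lemma pred_efg_output_subset:
  assumes components: "\<And>p. (\<lambda>X. X p) \<in> borel_measurable M" and "m \<le> k"
  shows "Measurable.pred M (\<lambda>X. efg_output m k n0 B X \<subseteq> G)"
proof -
  define T where "T = (LEAST t. B \<le> n0 * k + m * t)"
  note [measurable] = pred_efg_set_if_counts[OF components measurable_efg_counts[OF components]]
  have "efg_output m k n0 B X \<subseteq> G \<longleftrightarrow> (\<forall>i\<in>{..<k}. i \<in> efg_set m k n0 X T \<longrightarrow> i \<in> G)" for X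
    using efg_set_subset by (force simp: efg_output_eq efg_rounds_eq[OF assms(2)] T_def)
  then show ?thesis
    by simp
qed

section \<open>Probability of good selection\<close>

lemma (in finite_measure) measure_UN_lessThan_le:
  fixes A :: "nat \<Rightarrow> 'a set"
  assumes "\<And>i. i < n \<Longrightarrow> A i \<in> sets M" "\<And>i. i < n \<Longrightarrow> measure M (A i) \<le> b"
  shows "measure M (\<Union>i<n. A i) \<le> real n * b"
proof -
  have "measure M (\<Union>i<n. A i) \<le> (\<Sum>i<n. measure M (A i))"
    using assms(1) by (intro finite_measure_subadditive_finite) auto
  also have "\<dots> \<le> (\<Sum>i<n. b)"
    using assms(2) by (intro sum_mono) simp
  finally show ?thesis by simp
qed

lemma good_set_eq_lessThan:
  assumes "\<And>i j. i \<le> j \<Longrightarrow> j < k \<Longrightarrow> \<mu> j \<le> \<mu> i"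
  shows "good_set m \<delta> k \<mu> = {..<card (good_set m \<delta> k \<mu>)}"
proof -
  let ?G = "good_set m \<delta> k \<mu>"
  have fin: "finite ?G"
    by (rule finite_subset[of _ "{..<k}"]) (auto simp: good_set_def)
  have "i < card ?G" if "i \<in> ?G" for i
  proof -
    have "{..i} \<subseteq> ?G"
    proof
      fix j assume "j \<in> {..i}"
      with that assms[of j i] show "j \<in> ?G"
        by (simp add: good_set_def)
    qed
    from card_mono[OF fin this] show ?thesis by simp
  qed
  then show ?thesis
    by (intro card_subset_eq) auto
qed

text \<open>The variances enter only through \<open>a\<close>, which will be \<open>\<delta> / (2 * \<sigma>bar)\<close>.\<close>

locale screening_problem =
  fixes m k :: nat and \<delta> a :: real and \<mu> \<sigma> :: "nat \<Rightarrow> real"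
  assumes m_pos: "0 < m" and m_le: "m \<le> k" and a_pos: "0 < a"
    and sorted: "\<And>i j. i \<le> j \<Longrightarrow> j < k \<Longrightarrow> \<mu> j \<le> \<mu> i"
    and \<sigma>_pos: "\<And>i. i < k \<Longrightarrow> 0 < \<sigma> i"
    and \<sigma>_le: "\<And>i. i < k \<Longrightarrow> \<sigma> i * a \<le> \<delta> / 2"
begin

definition num_good :: nat where
  "num_good = card (good_set m \<delta> k \<mu>)"

lemma good_set_eq: "good_set m \<delta> k \<mu> = {..<num_good}"
  unfolding num_good_def by (rule good_set_eq_lessThan) (rule sorted)

lemma \<delta>_pos: "0 < \<delta>"
  using mult_pos_pos[OF \<sigma>_pos[of 0] a_pos] \<sigma>_le[of 0] m_pos m_le by simp

lemma m_le_num_good: "m \<le> num_good"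
proof -
  have "{..<m} \<subseteq> good_set m \<delta> k \<mu>"
  proof
    fix i assume "i \<in> {..<m}"
    then have "i < k" "\<mu> (m - 1) \<le> \<mu> i"
      using m_pos m_le by (auto intro: sorted)
    then show "i \<in> good_set m \<delta> k \<mu>"
      using \<delta>_pos by (simp add: good_set_def)
  qed
  then show ?thesis
    by (simp add: good_set_eq lessThan_subset_iff)
qed

lemma num_good_le_k: "num_good \<le> k"
proof -
  have "{..<num_good} \<subseteq> {..<k}"
    unfolding good_set_eq[symmetric] by (auto simp: good_set_def)
  then show ?thesis
    by (simp add: lessThan_subset_iff)
qed

definition threshold :: real where
  "threshold = \<mu> (m - 1) - \<delta> / 2"

lemma running_mean_normal_array_mono:
  assumes "i < k" "n \<in> {1..N}" "p \<in> {1..N}" "running_mean (curry z i) p \<le> running_mean (curry z i) n"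
  shows "running_mean (curry (normal_array \<mu> \<sigma> k N z) i) p
    \<le> running_mean (curry (normal_array \<mu> \<sigma> k N z) i) n"
  using assms mult_left_mono[OF assms(4), of "\<sigma> i"] \<sigma>_pos[of i] by (simp add: running_mean_normal_array)

lemma threshold_le_running_mean:
  assumes "i < m" "n \<in> {1..N}" "- a < running_mean (curry z i) n"
  shows "threshold \<le> running_mean (curry (normal_array \<mu> \<sigma> k N z) i) n"
proof -
  have top_alternative: "i < k" "\<mu> (m - 1) \<le> \<mu> i"
    using assms(1) m_le by (auto intro: sorted)
  have "\<sigma> i * - a \<le> \<sigma> i * running_mean (curry z i) n"
    using assms(3) \<sigma>_pos[OF top_alternative(1)] by (intro mult_left_mono) auto
  then show ?thesis
    using assms(2) top_alternative \<sigma>_le[OF top_alternative(1)]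
    by (simp add: threshold_def running_mean_normal_array)
qed

lemma le_running_mean_if_threshold_le:
  assumes "num_good \<le> i" "i < k" "n \<in> {1..N}"
    and ge: "threshold \<le> running_mean (curry (normal_array \<mu> \<sigma> k N z) i) n"
  shows "a \<le> running_mean (curry z i) n"
proof (rule ccontr)
  assume "\<not> ?thesis"
  then have "\<sigma> i * running_mean (curry z i) n \<le> \<sigma> i * a"
    using \<sigma>_pos[OF assms(2)] by (intro mult_left_mono) auto
  then have "\<sigma> i * running_mean (curry z i) n \<le> \<delta> / 2"
    using \<sigma>_le[OF assms(2)] by simp
  moreover have "i \<notin> good_set m \<delta> k \<mu>"
    using assms(1) by (simp add: good_set_eq)
  then have "\<mu> i < \<mu> (m - 1) - \<delta>"
    using assms(2) by (simp add: good_set_def)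
  ultimately show False
    using ge assms(2,3) by (simp add: threshold_def running_mean_normal_array)
qed

lemma sum_exceed_count_threshold_le:
  assumes "1 \<le> l" "u \<le> N"
  shows "(\<Sum>i\<in>{num_good..<k}. exceed_count threshold {l..<u} (curry (normal_array \<mu> \<sigma> k N z) i))
    \<le> (\<Sum>i<k. exceed_count a {l..<N} (curry z i))"
proof -
  have "exceed_count threshold {l..<u} (curry (normal_array \<mu> \<sigma> k N z) i)
      \<le> exceed_count a {l..<N} (curry z i)"
    if "i \<in> {num_good..<k}" for i
    unfolding exceed_count_def using assms that
    by (intro card_mono) (auto intro!: le_running_mean_if_threshold_le[where N = N])
  then have "(\<Sum>i\<in>{num_good..<k}. exceed_count threshold {l..<u} (curry (normal_array \<mu> \<sigma> k N z) i))
      \<le> (\<Sum>i\<in>{num_good..<k}. exceed_count a {l..<N} (curry z i))"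
    by (rule sum_mono)
  also have "\<dots> \<le> (\<Sum>i<k. exceed_count a {l..<N} (curry z i))"
    by (rule sum_mono2) auto
  finally show ?thesis .
qed

lemma efg_output_subset_good_set:
  assumes "1 \<le> n0" "n0 \<le> L"
    and top: "\<And>i n. i < m \<Longrightarrow> n0 \<le> n \<Longrightarrow> - a < running_mean (curry z i) n"
    and early: "\<And>i. i < num_good \<Longrightarrow> \<not> late_minimum n0 L (curry z i)"
    and budget: "n0 * k + m * (num_good * L + (\<Sum>i<k. exceed_count a {n0..<n0 + B} (curry z i))) < B"
  shows "efg_output m k n0 B (normal_array \<mu> \<sigma> k (n0 + B) z) \<subseteq> good_set m \<delta> k \<mu>"
proof -
  define N where "N = n0 + B"
  define X where "X = normal_array \<mu> \<sigma> k N z"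
  define T where "T = efg_rounds m k n0 B X"
  have T_bounds: "T \<le> B" "B \<le> n0 * k + m * T"
    unfolding T_def by (rule efg_rounds_le budget_le_efg_rounds; rule m_pos m_le)+
  have "1 * L \<le> m * (num_good * L)"
    using m_pos m_le_num_good by (simp add: Suc_le_eq)
  with budget have L_le_N: "L \<le> N"
    unfolding add_mult_distrib2 N_def by linarith
  have "efg_set m k n0 X T \<subseteq> {..<num_good}"
  proof (rule efg_set_subset_lessThan)
    show "threshold \<le> running_mean (curry X i) n" if "i < m" "n \<in> {n0..<n0 + T}" for i n
      unfolding X_def using that top T_bounds(1) \<open>1 \<le> n0\<close>
      by (intro threshold_le_running_mean) (auto simp: N_def)
    show "\<exists>p\<in>{n0..L}. running_mean (curry X i) p \<le> running_mean (curry X i) n"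
      if i_less: "i < num_good" and n_range: "n \<in> {n0..n0 + T}" for i n
    proof -
      obtain p where "p \<in> {n0..L}" "running_mean (curry z i) p \<le> running_mean (curry z i) n"
        using early[OF i_less] n_range by (auto simp: late_minimum_def not_less)
      then show ?thesis
        unfolding X_def using i_less n_range num_good_le_k T_bounds(1) L_le_N \<open>1 \<le> n0\<close>
        by (intro bexI[of _ p] running_mean_normal_array_mono) (auto simp: N_def)
    qed
    have "m * (num_good * L + (\<Sum>i<k. exceed_count a {n0..<N} (curry z i))) < m * T"
      using budget T_bounds(2) unfolding N_def by linarith
    then show "num_good * L + (\<Sum>i\<in>{num_good..<k}. exceed_count threshold {n0..<n0 + T} (curry X i)) < T"
      using sum_exceed_count_threshold_le[OF \<open>1 \<le> n0\<close>, of "n0 + T" N z] T_bounds(1)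
      by (simp add: X_def N_def)
  qed (use m_pos m_le_num_good num_good_le_k \<open>n0 \<le> L\<close> in auto)
  then show ?thesis
    by (simp add: efg_output_eq good_set_eq T_def X_def N_def)
qed

lemma efg_output_subset_good_set_real:
  assumes "1 \<le> n0" "n0 \<le> L"
    and "\<And>i n. i < m \<Longrightarrow> n0 \<le> n \<Longrightarrow> - a < running_mean (curry z i) n"
    and "\<And>i. i < num_good \<Longrightarrow> \<not> late_minimum n0 L (curry z i)"
    and few: "(\<Sum>i<k. real (exceed_count a {n0..<n0 + B} (curry z i))) < s"
    and budget: "real (n0 * k) + real m * (real (num_good * L) + s) \<le> real B"
  shows "efg_output m k n0 B (normal_array \<mu> \<sigma> k (n0 + B) z) \<subseteq> good_set m \<delta> k \<mu>"
proof (rule efg_output_subset_good_set[OF assms(1-4)])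
  let ?E = "\<Sum>i<k. exceed_count a {n0..<n0 + B} (curry z i)"
  have "real m * (real (num_good * L) + real ?E) < real m * (real (num_good * L) + s)"
    using few m_pos by (intro mult_strict_left_mono) auto
  with budget have "real (n0 * k + m * (num_good * L + ?E)) < real B"
    by (simp only: of_nat_add of_nat_mult)
  then show "n0 * k + m * (num_good * L + ?E) < B"
    by (simp only: of_nat_less_iff)
qed

lemma PGS_eq_prob_gauss_array:
  assumes "1 \<le> n0"
  shows "PGS m \<delta> k n0 B \<mu> \<sigma>
    = \<P>(z in gauss_array. efg_output m k n0 B (normal_array \<mu> \<sigma> k (n0 + B) z) \<subseteq> good_set m \<delta> k \<mu>)"
proof -
  let ?M = "obs_space \<mu> \<sigma> k (n0 + B)" and ?f = "normal_array \<mu> \<sigma> k (n0 + B)"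
  let ?S = "{X \<in> space ?M. efg_output m k n0 B X \<subseteq> good_set m \<delta> k \<mu>}"
  note [measurable] = pred_efg_output_subset[OF measurable_obs_space_component m_le]
  have "measure (distr gauss_array ?M ?f) ?S = gauss_array.prob (?f -` ?S \<inter> space gauss_array)"
    by (rule measure_distr) measurable
  also have "distr gauss_array ?M ?f = ?M"
    using assms m_pos m_le by (intro distr_normal_array \<sigma>_pos) auto
  also have "?f -` ?S \<inter> space gauss_array
      = {z \<in> space gauss_array. efg_output m k n0 B (?f z) \<subseteq> good_set m \<delta> k \<mu>}"
    using measurable_space[OF measurable_normal_array] by blast
  finally show ?thesis
    by (simp add: PGS_def Let_def)
qed

lemma one_le_PGS_add:
  assumes "1 \<le> n0" "n0 \<le> L"
    and budget: "real (n0 * k) + real m * (real (num_good * L) + s) \<le> real B"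
  shows "1 \<le> PGS m \<delta> k n0 B \<mu> \<sigma> + (real m * gauss_tail a ^ n0
    + real num_good * \<P>(x in gauss_seq. late_minimum n0 L x)
    + \<P>(z in gauss_array. s \<le> (\<Sum>i<k. real (exceed_count a {n0..<n0 + B} (curry z i)))))"
proof -
  let ?P = gauss_array.prob
  define S where "S = {z \<in> space gauss_array.
    efg_output m k n0 B (normal_array \<mu> \<sigma> k (n0 + B) z) \<subseteq> good_set m \<delta> k \<mu>}"
  define low where "low i = {z \<in> space gauss_array. \<exists>n\<ge>n0. running_mean (curry z i) n \<le> - a}" for i
  define late where "late i = {z \<in> space gauss_array. late_minimum n0 L (curry z i)}" for i
  define many where "many = {z \<in> space gauss_array.
    s \<le> (\<Sum>i<k. real (exceed_count a {n0..<n0 + B} (curry z i)))}"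
  have [measurable]: "S \<in> sets gauss_array"
    unfolding S_def
    using measurable_compose[OF measurable_normal_array
      pred_efg_output_subset[OF measurable_obs_space_component m_le]]
    by (rule predE)
  have [measurable]: "low i \<in> sets gauss_array" "late i \<in> sets gauss_array" "many \<in> sets gauss_array" for i
    unfolding low_def late_def many_def by measurable
  have "z \<in> S"
    if z_ordinary: "z \<in> space gauss_array" "\<forall>i<m. z \<notin> low i" "\<forall>i<num_good. z \<notin> late i" "z \<notin> many" for z
  proof -
    have "\<not> running_mean (curry z i) n \<le> - a" if "i < m" "n0 \<le> n" for i n
      using z_ordinary(1,2) that unfolding low_def by blast
    then show ?thesis
      using efg_output_subset_good_set_real[OF assms(1,2) _ _ _ budget, of z] z_ordinary
      by (simp add: S_def late_def many_def not_le)
  qed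
  then have "space gauss_array \<subseteq> S \<union> ((\<Union>i<m. low i) \<union> (\<Union>i<num_good. late i) \<union> many)"
    by auto
  then have "?P (space gauss_array) \<le> ?P (S \<union> ((\<Union>i<m. low i) \<union> (\<Union>i<num_good. late i) \<union> many))"
    by (rule gauss_array.finite_measure_mono) measurable
  also have "\<dots> \<le> ?P S + (?P (\<Union>i<m. low i) + ?P (\<Union>i<num_good. late i) + ?P many)"
    by (intro order_trans[OF measure_Un_le] add_left_mono add_right_mono order_refl) measurable
  also have "?P (\<Union>i<m. low i) \<le> real m * gauss_tail a ^ n0"
  proof (rule gauss_array.measure_UN_lessThan_le)
    show "?P (low i) \<le> gauss_tail a ^ n0" for i
      unfolding low_def using prob_gauss_seq_mean_le[OF a_pos assms(1)]
      by (subst prob_curry_gauss_array) auto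
  qed measurable
  also have "?P (\<Union>i<num_good. late i) \<le> real num_good * \<P>(x in gauss_seq. late_minimum n0 L x)"
    by (intro gauss_array.measure_UN_lessThan_le)
      (simp_all add: late_def prob_curry_gauss_array[OF measurable_late_minimum])
  finally show ?thesis
    by (simp add: gauss_array.prob_space PGS_eq_prob_gauss_array[OF assms(1)] S_def many_def)
qed

lemma PGS_ge:
  assumes "1 \<le> n0" "n0 \<le> L" "0 < \<gamma>" and gbar: "num_good \<le> gbar"
    and budget: "real m * (real gbar * real L)
      + (real n0 + real m * (gauss_tail a ^ n0 / (1 - gauss_tail a) + \<gamma>)) * real k \<le> real B"
  shows "1 - (real m * gauss_tail a ^ n0 + real gbar * \<P>(x in gauss_seq. late_minimum n0 L x)
    + 2 / (1 - gauss_tail a)\<^sup>2 / (\<gamma>\<^sup>2 * real k)) \<le> PGS m \<delta> k n0 B \<mu> \<sigma>"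
proof -
  let ?s = "(gauss_tail a ^ n0 / (1 - gauss_tail a) + \<gamma>) * real k"
    and ?late = "\<P>(x in gauss_seq. late_minimum n0 L x)"
  have "real m * real (num_good * L) \<le> real m * (real gbar * real L)"
    using gbar by (simp add: mult_left_mono mult_right_mono)
  with budget have "real (n0 * k) + real m * (real (num_good * L) + ?s) \<le> real B"
    by (simp add: algebra_simps)
  then have "1 \<le> PGS m \<delta> k n0 B \<mu> \<sigma> + (real m * gauss_tail a ^ n0 + real num_good * ?late
      + \<P>(z in gauss_array. ?s \<le> (\<Sum>i<k. real (exceed_count a {n0..<n0 + B} (curry z i)))))"
    by (rule one_le_PGS_add[OF assms(1,2)])
  moreover have "\<P>(z in gauss_array. ?s \<le> (\<Sum>i<k. real (exceed_count a {n0..<n0 + B} (curry z i))))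
      \<le> 2 / (1 - gauss_tail a)\<^sup>2 / (\<gamma>\<^sup>2 * real k)"
    using m_pos m_le by (intro prob_sum_exceed_count_ge_le a_pos assms(1,3)) simp
  moreover have "real num_good * ?late \<le> real gbar * ?late"
    using gbar by (intro mult_right_mono) auto
  ultimately show ?thesis
    by simp
qed

end

lemma filterlim_mult_real_sequentially:
  fixes d :: real
  shows "0 < d \<Longrightarrow> filterlim (\<lambda>k. d * real k) at_top sequentially"
  by (rule filterlim_tendsto_pos_mult_at_top[OF tendsto_const _ filterlim_real_sequentially])

lemma eventually_affine_le_nat_floor:
  fixes b c d :: real
  assumes "d < c"
  shows "\<forall>\<^sub>F k in sequentially. b + d * real k \<le> real (nat \<lfloor>c * real k\<rfloor>)"
proof -
  have "filterlim (\<lambda>k. (c - d) * real k) at_top sequentially"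
    using assms by (intro filterlim_mult_real_sequentially) simp
  then have "\<forall>\<^sub>F k in sequentially. b + 1 \<le> (c - d) * real k"
    by (simp add: filterlim_at_top)
  then show ?thesis
  proof eventually_elim
    case (elim k)
    have "c * real k - 1 \<le> real (nat \<lfloor>c * real k\<rfloor>)"
      by linarith
    with elim show ?case
      by (simp add: algebra_simps)
  qed
qed

lemma eventually_divide_mult_real_less:
  fixes b d \<epsilon> :: real
  assumes "0 < d" "0 < \<epsilon>"
  shows "\<forall>\<^sub>F k in sequentially. b / (d * real k) < \<epsilon>"
proof (rule order_tendstoD)
  show "(\<lambda>k. b / (d * real k)) \<longlonglongrightarrow> 0"
    using assms(1)
    by (intro tendsto_divide_0[OF tendsto_const] filterlim_at_top_imp_at_infinity
        filterlim_mult_real_sequentially)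
qed fact

lemma liminf_PGS_ge:
  fixes \<mu> \<sigma> :: "nat \<Rightarrow> nat \<Rightarrow> real"
  assumes problem: "\<And>k. m \<le> k \<Longrightarrow> screening_problem m k \<delta> a (\<mu> k) (\<sigma> k)"
    and gbar: "\<And>k. card (good_set m \<delta> k (\<mu> k)) \<le> gbar" and "1 \<le> n0"
    and budget: "real n0 + real m * (gauss_tail a ^ n0 / (1 - gauss_tail a)) < c"
  shows "ereal (1 - real m * gauss_tail a ^ n0)
    \<le> liminf (\<lambda>k. ereal (PGS m \<delta> k n0 (nat \<lfloor>c * real k\<rfloor>) (\<mu> k) (\<sigma> k)))"
    (is "_ \<le> ?liminf")
proof (rule ereal_le_epsilon2)
  let ?q = "gauss_tail a"
  fix \<epsilon> :: real assume "0 < \<epsilon>"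
  then obtain L where L_props: "n0 \<le> L" "real gbar * \<P>(x in gauss_seq. late_minimum n0 L x) < \<epsilon> / 2"
    using exists_mult_prob_late_minimum_less[OF \<open>1 \<le> n0\<close>, of "\<epsilon> / 2" "real gbar"] by auto
  have "0 < m"
    using screening_problem.m_pos[OF problem[of m]] by simp
  obtain c' where c'_between: "real n0 + real m * (?q ^ n0 / (1 - ?q)) < c'" "c' < c"
    using dense[OF budget] by blast
  define \<gamma> where "\<gamma> = (c' - real n0) / real m - ?q ^ n0 / (1 - ?q)"
  have "0 < \<gamma>" and \<gamma>: "real n0 + real m * (?q ^ n0 / (1 - ?q) + \<gamma>) = c'"
    using c'_between(1) \<open>0 < m\<close> by (simp_all add: \<gamma>_def pos_less_divide_eq mult.commute)
  have "\<forall>\<^sub>F k in sequentially. 2 / (1 - ?q)\<^sup>2 / (\<gamma>\<^sup>2 * real k) < \<epsilon> / 2"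
    using \<open>0 < \<gamma>\<close> \<open>0 < \<epsilon>\<close> by (intro eventually_divide_mult_real_less) auto
  moreover have "\<forall>\<^sub>F k in sequentially. real m * (real gbar * real L) + c' * real k \<le> real (nat \<lfloor>c * real k\<rfloor>)"
    by (rule eventually_affine_le_nat_floor) fact
  ultimately have "\<forall>\<^sub>F k in sequentially.
      ereal (1 - real m * ?q ^ n0 - \<epsilon>) \<le> ereal (PGS m \<delta> k n0 (nat \<lfloor>c * real k\<rfloor>) (\<mu> k) (\<sigma> k))"
    using eventually_ge_at_top[of m]
  proof eventually_elim
    case (elim k)
    interpret screening_problem m k \<delta> a "\<mu> k" "\<sigma> k"
      by (rule problem) fact
    have "num_good \<le> gbar"
      unfolding num_good_def by (rule gbar)
    from PGS_ge[OF \<open>1 \<le> n0\<close> L_props(1) \<open>0 < \<gamma>\<close> this, unfolded \<gamma>, OF elim(2)] show ?case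
      using elim(1) L_props(2) by simp
  qed
  then have "ereal (1 - real m * ?q ^ n0 - \<epsilon>) + ereal \<epsilon> \<le> ?liminf + ereal \<epsilon>"
    by (intro add_right_mono Liminf_bounded)
  then show "ereal (1 - real m * ?q ^ n0) \<le> ?liminf + ereal \<epsilon>"
    by simp
qed

lemma inverse_one_minus_exp_less:
  fixes x :: real
  assumes "0 < x"
  shows "1 / (1 - exp (- x)) < 1 + 1 / x"
proof -
  have "1 + x < exp x"
    using assms exp_minus_greater[of "- x"] by simp
  then show ?thesis
    using assms by (simp add: exp_minus field_simps)
qed

lemma exp_power_nat_ceiling_ln_le:
  fixes x y :: real
  assumes "0 < x" "0 < y"
  shows "exp (- x) ^ nat \<lceil>ln y / x\<rceil> \<le> 1 / y"
proof -
  let ?n = "nat \<lceil>ln y / x\<rceil>"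
  have "ln y \<le> real ?n * x"
    using real_nat_ceiling_ge[of "ln y / x"] assms(1) by (simp only: pos_divide_le_eq)
  have "exp (- x) ^ ?n = exp (real ?n * - x)"
    by (simp only: exp_of_nat_mult)
  also have "\<dots> \<le> exp (- ln y)"
    using \<open>ln y \<le> real ?n * x\<close> by simp
  also have "\<dots> = 1 / y"
    using assms(2) by (simp add: exp_minus inverse_eq_divide)
  finally show ?thesis .
qed

lemma screening_problem_if_variance_le:
  assumes "0 < m" "m \<le> k" "0 < \<delta>" "0 < \<sigma>bar"
    and "\<And>i j. i \<le> j \<Longrightarrow> j < k \<Longrightarrow> \<mu> j \<le> \<mu> i"
    and \<sigma>: "\<And>i. i < k \<Longrightarrow> 0 < \<sigma> i" "\<And>i. i < k \<Longrightarrow> (\<sigma> i)\<^sup>2 \<le> \<sigma>bar\<^sup>2"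
  shows "screening_problem m k \<delta> (\<delta> / (2 * \<sigma>bar)) \<mu> \<sigma>"
proof
  fix i assume "i < k"
  then have "\<sigma> i \<le> \<sigma>bar"
    using \<sigma>(2) \<open>0 < \<sigma>bar\<close> by (intro power2_le_imp_le[of "\<sigma> i"]) auto
  then have "\<sigma> i * (\<delta> / (2 * \<sigma>bar)) \<le> \<sigma>bar * (\<delta> / (2 * \<sigma>bar))"
    using assms by (intro mult_right_mono) auto
  then show "\<sigma> i * (\<delta> / (2 * \<sigma>bar)) \<le> \<delta> / 2"
    using \<open>0 < \<sigma>bar\<close> by simp
qed (use assms in auto)

lemma liminf_PGS_ge_one_minus:
  fixes m gbar :: nat and \<delta> \<sigma>bar :: real and \<mu> \<sigma> :: "nat \<Rightarrow> nat \<Rightarrow> real"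
  assumes m_gt: "m > 1" and \<delta>: "\<delta> > 0" and \<sigma>bar: "\<sigma>bar > 0"
    and sorted: "\<forall>k i j. i \<le> j \<and> j < k \<longrightarrow> \<mu> k j \<le> \<mu> k i"
    and var: "\<forall>k i. i < k \<longrightarrow> \<sigma> k i > 0 \<and> (\<sigma> k i)\<^sup>2 \<le> \<sigma>bar\<^sup>2"
    and gbar: "\<forall>k. card (good_set m \<delta> k (\<mu> k)) \<le> gbar"
    and \<alpha>: "0 < \<alpha>" "\<alpha> < 1" and ng: "ng \<ge> \<alpha> / 2 + 4 * \<alpha> * \<sigma>bar\<^sup>2 / \<delta>\<^sup>2"
    and n0_def: "n0 = nat \<lceil>8 * \<sigma>bar\<^sup>2 / \<delta>\<^sup>2 * ln (2 * real m / \<alpha>)\<rceil>"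
  shows "liminf (\<lambda>k. ereal (PGS m \<delta> k n0 (nat \<lfloor>(real n0 + ng) * real k\<rfloor>) (\<mu> k) (\<sigma> k))) \<ge> ereal (1 - \<alpha>)"
proof -
  define a where "a = \<delta> / (2 * \<sigma>bar)"
  define x where "x = a\<^sup>2 / 2"
  have "0 < x" and inverse_x: "8 * \<sigma>bar\<^sup>2 / \<delta>\<^sup>2 = 1 / x"
    using \<delta> \<sigma>bar by (simp_all add: x_def a_def power_divide power_mult_distrib)
  have tail: "gauss_tail a = exp (- x)"
    by (simp add: gauss_tail_def x_def)
  have n0_eq: "n0 = nat \<lceil>ln (2 * real m / \<alpha>) / x\<rceil>"
    by (simp add: n0_def inverse_x)
  have "0 < ln (2 * real m / \<alpha>) / x"
    using m_gt \<alpha> \<open>0 < x\<close> by (simp add: field_simps)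
  then have "1 \<le> n0"
    unfolding n0_eq by linarith
  have m_tail: "real m * exp (- x) ^ n0 \<le> \<alpha> / 2"
    using exp_power_nat_ceiling_ln_le[OF \<open>0 < x\<close>, of "2 * real m / \<alpha>"] m_gt \<alpha>
    by (simp add: n0_eq field_simps)
  have "real m * (exp (- x) ^ n0 / (1 - exp (- x))) \<le> \<alpha> / 2 * (1 / (1 - exp (- x)))"
    using mult_right_mono[OF m_tail, of "1 / (1 - exp (- x))"] \<open>0 < x\<close> by simp
  also have "\<dots> < \<alpha> / 2 * (1 + 1 / x)"
    using inverse_one_minus_exp_less[OF \<open>0 < x\<close>] \<alpha> by (intro mult_strict_left_mono) auto
  also have "\<dots> = \<alpha> / 2 + 4 * \<alpha> * \<sigma>bar\<^sup>2 / \<delta>\<^sup>2"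
    unfolding inverse_x[symmetric] by (simp add: field_simps)
  also have "\<dots> \<le> ng"
    by (rule ng)
  finally have "real m * (exp (- x) ^ n0 / (1 - exp (- x))) < ng" .
  moreover have "screening_problem m k \<delta> a (\<mu> k) (\<sigma> k)" if "m \<le> k" for k
    unfolding a_def using that m_gt \<delta> \<sigma>bar sorted var by (intro screening_problem_if_variance_le) auto
  ultimately have "ereal (1 - real m * exp (- x) ^ n0)
      \<le> liminf (\<lambda>k. ereal (PGS m \<delta> k n0 (nat \<lfloor>(real n0 + ng) * real k\<rfloor>) (\<mu> k) (\<sigma> k)))"
    using gbar \<open>1 \<le> n0\<close> unfolding tail[symmetric] by (intro liminf_PGS_ge) auto
  moreover have "ereal (1 - \<alpha>) \<le> ereal (1 - real m * exp (- x) ^ n0)"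
    using m_tail \<alpha> by simp
  ultimately show ?thesis
    by (rule order_trans[rotated])
qed

theorem theorem2:
  fixes m gbar :: nat and \<delta> \<sigma>bar :: real and \<mu> \<sigma> :: "nat \<Rightarrow> nat \<Rightarrow> real"
  assumes m_gt: "m > 1" and delta_pos: "\<delta> > 0" and sbar_pos: "\<sigma>bar > 0"
    and sorted: "\<forall>k i j. i \<le> j \<and> j < k \<longrightarrow> \<mu> k j \<le> \<mu> k i"
    and var_bound: "\<forall>k i. i < k \<longrightarrow> \<sigma> k i > 0 \<and> (\<sigma> k i)\<^sup>2 \<le> \<sigma>bar\<^sup>2"
    and good_bound: "\<forall>k. card (good_set m \<delta> k (\<mu> k)) \<le> gbar"
  shows "(\<forall>\<alpha> ng. 0 < \<alpha> \<and> \<alpha> < 1 \<and> ng \<ge> \<alpha> / 2 + 4 * \<alpha> * \<sigma>bar\<^sup>2 / \<delta>\<^sup>2 \<longrightarrow>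
            (let n0 = nat \<lceil>8 * \<sigma>bar\<^sup>2 / \<delta>\<^sup>2 * ln (2 * real m / \<alpha>)\<rceil>
             in liminf (\<lambda>k. ereal (PGS m \<delta> k n0 (nat \<lfloor>(real n0 + ng) * real k\<rfloor>) (\<mu> k) (\<sigma> k)))
                  \<ge> ereal (1 - \<alpha>)))
       \<and> (\<forall>\<alpha>. 0 < \<alpha> \<and> \<alpha> < 1 \<longrightarrow>
            (\<exists>c > 0. \<exists>n0::nat. real n0 < c \<and>
               liminf (\<lambda>k. ereal (PGS m \<delta> k n0 (nat \<lfloor>c * real k\<rfloor>) (\<mu> k) (\<sigma> k)))
                 \<ge> ereal (1 - \<alpha>)))"
proof (intro conjI allI impI)
  note liminf_PGS = liminf_PGS_ge_one_minus[OF m_gt delta_pos sbar_pos sorted var_bound good_bound]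
  fix \<alpha> :: real
  show "let n0 = nat \<lceil>8 * \<sigma>bar\<^sup>2 / \<delta>\<^sup>2 * ln (2 * real m / \<alpha>)\<rceil>
      in liminf (\<lambda>k. ereal (PGS m \<delta> k n0 (nat \<lfloor>(real n0 + ng) * real k\<rfloor>) (\<mu> k) (\<sigma> k))) \<ge> ereal (1 - \<alpha>)"
    if "0 < \<alpha> \<and> \<alpha> < 1 \<and> ng \<ge> \<alpha> / 2 + 4 * \<alpha> * \<sigma>bar\<^sup>2 / \<delta>\<^sup>2" for ng
    unfolding Let_def using that by (intro liminf_PGS) auto
  assume \<alpha>: "0 < \<alpha> \<and> \<alpha> < 1"
  define n0 where "n0 = nat \<lceil>8 * \<sigma>bar\<^sup>2 / \<delta>\<^sup>2 * ln (2 * real m / \<alpha>)\<rceil>"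
  define ng where "ng = \<alpha> / 2 + 4 * \<alpha> * \<sigma>bar\<^sup>2 / \<delta>\<^sup>2"
  have "0 < ng"
    unfolding ng_def using \<alpha> delta_pos sbar_pos by (intro add_pos_pos) auto
  moreover have "liminf (\<lambda>k. ereal (PGS m \<delta> k n0 (nat \<lfloor>(real n0 + ng) * real k\<rfloor>) (\<mu> k) (\<sigma> k))) \<ge> ereal (1 - \<alpha>)"
    using \<alpha> by (intro liminf_PGS n0_def) (auto simp: ng_def)
  ultimately show "\<exists>c > 0. \<exists>n0::nat. real n0 < c \<and>
      liminf (\<lambda>k. ereal (PGS m \<delta> k n0 (nat \<lfloor>c * real k\<rfloor>) (\<mu> k) (\<sigma> k))) \<ge> ereal (1 - \<alpha>)"
    by (intro exI[of _ "real n0 + ng"] conjI exI[of _ n0]) auto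
qed

end
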